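(* Let $r,s$ be positive integers and let $\lambda=(\lambda_1,\ldots,\lambda_r)$, $\mu=(\mu_1,\ldots,\mu_r)$ be partitions (zero parts allowed) with $\mu\subset\lambda\subset(s^r)$ and conjugates $\lambda'=(\lambda'_1,\ldots,\lambda'_s)$, $\mu'=(\mu'_1,\ldots,\mu'_s)$ (zero parts allowed). Let $\boldsymbol{\gamma}=(\gamma_{ij})\in T^{\mathrm{diag}}(\lambda/\mu,\mathbb{N})$, and let $(c_k)_{k\in\mathbb{Z}}$ be positive integers with $\gamma_{ij}=c_{j-i}$ for all $(i,j)\in D(\lambda/\mu)$. Then: (1) $$S_{\lambda/\mu}(\boldsymbol{\gamma})=\det\left[E_{(c_{\mu_j-j+1},c_{\mu_j-j+2},\ldots,c_{\mu_j-j+(\lambda_i-\mu_j-i+j)})}\right]_{1\le i,j\le r},$$ where the $(i,j)$ entry is understood to be $1$ if $\lambda_i-\mu_j-i+j=0$ and $0$ if $\lambda_i-\mu_j-i+j<0$. (2) $$S_{\lambda/\mu}(\boldsymbol{\gamma})=\det\left[M_{(c_{-\mu'_j+j-1},c_{-\mu'_j+j-2},\ldots,c_{-\mu'_j+j-(\lambda'_i-\mu'_j-i+j)})}\right]_{1\le i,j\le s},$$ where the $(i,j)$ entry is understood to be $1$ if $\lambda'_i-\mu'_j-i+j=0$ and $0$ if $\lambda'_i-\mu'_j-i+j<0$.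
   Context: $\mathbb{N}$ denotes the positive integers; $t_1,t_2,\ldots$ are commuting variables and identities hold in the ring of formal power series of bounded degree in $\mathbb{Z}[[t_1,t_2,\ldots]]$. For a composition $(\gamma_1,\ldots,\gamma_n)$ (a finite sequence of positive integers), the monomial and essential quasi-symmetric functions are $$M_{(\gamma_1,\ldots,\gamma_n)}=\sum_{m_1<\cdots<m_n}t_{m_1}^{\gamma_1}\cdots t_{m_n}^{\gamma_n},\qquad E_{(\gamma_1,\ldots,\gamma_n)}=\sum_{m_1\le\cdots\le m_n}t_{m_1}^{\gamma_1}\cdots t_{m_n}^{\gamma_n}.$$ $D(\lambda)=\{(i,j):1\le j\le\lambda_i\}$, $D(\lambda/\mu)=D(\lambda)\setminus D(\mu)$, $(s^r)$ is the partition with $r$ parts equal to $s$, $\lambda'_i=\#\{j:\lambda_j\ge i\}$. $T(\lambda/\mu,\mathbb{N})$ is the set of fillings of $D(\lambda/\mu)$ by positive integers, $T^{\mathrm{diag}}(\lambda/\mu,\mathbb{N})$ the subset with $t_{ij}=t_{kl}$ whenever $j-i=l-k$, and $\mathrm{SSYT}(\lambda/\mu)$ the subset of semi-standard ones (rows weakly increasing, columns strictly increasing). The Schur type quasi-symmetric function is $$S_{\lambda/\mu}(\boldsymbol{\gamma})=\sum_{(m_{ij})\in\mathrm{SSYT}(\lambda/\mu)}\ \prod_{(i,j)\in D(\lambda/\mu)}t_{m_{ij}}^{\gamma_{ij}}.$$ *)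

theory Defs
  imports "HOL-Library.Poly_Mapping" "HOL-Library.FuncSet" "Jordan_Normal_Form.Determinant"
begin

section \<open>Formal power series of bounded degree\<close>

text \<open>
  A monomial in the variables \<open>t\<^sub>m\<close> is its exponent vector, a finitely supported function
  of type \<open>nat \<Rightarrow>\<^sub>0 nat\<close>. The series below never involve the variable with index \<open>0\<close>:
  they only use \<open>t\<^sub>1, t\<^sub>2, \<dots>\<close>.
\<close>

definition mdeg :: "(nat \<Rightarrow>\<^sub>0 nat) \<Rightarrow> nat" where
  "mdeg \<alpha> = (\<Sum>i\<in>Poly_Mapping.keys \<alpha>. Poly_Mapping.lookup \<alpha> i)"

lemma mdeg_superset:
  assumes "finite A" "Poly_Mapping.keys \<alpha> \<subseteq> A"
  shows "mdeg \<alpha> = (\<Sum>i\<in>A. Poly_Mapping.lookup \<alpha> i)"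
  unfolding mdeg_def
  by (rule sum.mono_neutral_left) (use assms in \<open>auto simp: in_keys_iff\<close>)

lemma mdeg_0 [simp]: "mdeg 0 = 0"
  by (simp add: mdeg_def)

lemma mdeg_single [simp]: "mdeg (Poly_Mapping.single m k) = k"
  by (simp add: mdeg_def)

lemma mdeg_add [simp]: "mdeg (\<alpha> + \<beta>) = mdeg \<alpha> + mdeg \<beta>"
proof -
  define A where "A = Poly_Mapping.keys \<alpha> \<union> Poly_Mapping.keys \<beta>"
  have A: "finite A" "Poly_Mapping.keys \<alpha> \<subseteq> A" "Poly_Mapping.keys \<beta> \<subseteq> A"
    by (auto simp: A_def)
  have "Poly_Mapping.keys (\<alpha> + \<beta>) \<subseteq> A"
    unfolding A_def by (rule keys_add)
  then show ?thesis
    using A by (simp add: mdeg_superset[of A] lookup_add sum.distrib)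
qed

lemma mdeg_sum [simp]: "mdeg (\<Sum>i\<in>I. e i) = (\<Sum>i\<in>I. mdeg (e i))"
  by (induction I rule: infinite_finite_induct) auto

definition splits :: "(nat \<Rightarrow>\<^sub>0 nat) \<Rightarrow> ((nat \<Rightarrow>\<^sub>0 nat) \<times> (nat \<Rightarrow>\<^sub>0 nat)) set" where
  "splits \<alpha> = {(\<beta>, \<delta>). \<beta> + \<delta> = \<alpha>}"

lemma finite_splits [simp]: "finite (splits \<alpha>)"
proof -
  let ?K = "Poly_Mapping.keys \<alpha>"
  define B where "B = {\<beta> :: nat \<Rightarrow>\<^sub>0 nat. \<forall>i. Poly_Mapping.lookup \<beta> i \<le> Poly_Mapping.lookup \<alpha> i}"
  have "finite ((\<lambda>\<beta>. restrict (Poly_Mapping.lookup \<beta>) ?K) ` B)"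
  proof (rule finite_subset)
    show "(\<lambda>\<beta>. restrict (Poly_Mapping.lookup \<beta>) ?K) ` B
        \<subseteq> (\<Pi>\<^sub>E i\<in>?K. {..Poly_Mapping.lookup \<alpha> i})"
      by (auto simp: B_def)
  qed (auto intro: finite_PiE)
  moreover have "inj_on (\<lambda>\<beta>. restrict (Poly_Mapping.lookup \<beta>) ?K) B"
  proof (rule inj_onI)
    fix \<beta> \<delta> assume *: "\<beta> \<in> B" "\<delta> \<in> B"
      "restrict (Poly_Mapping.lookup \<beta>) ?K = restrict (Poly_Mapping.lookup \<delta>) ?K"
    show "\<beta> = \<delta>"
    proof (rule poly_mapping_eqI)
      fix i
      show "Poly_Mapping.lookup \<beta> i = Poly_Mapping.lookup \<delta> i"
      proof (cases "i \<in> ?K")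
        case True
        then show ?thesis using fun_cong[OF *(3), of i] by simp
      next
        case False
        then have "Poly_Mapping.lookup \<alpha> i = 0" by (simp add: in_keys_iff)
        then show ?thesis using *(1,2) by (metis (mono_tags, lifting) B_def le_zero_eq mem_Collect_eq)
      qed
    qed
  qed
  ultimately have "finite B"
    by (rule finite_imageD)
  moreover have "splits \<alpha> \<subseteq> B \<times> B"
    by (auto simp: splits_def B_def lookup_add)
  ultimately show ?thesis
    by (meson finite_SigmaI finite_subset)
qed

definition bounded_degree :: "((nat \<Rightarrow>\<^sub>0 nat) \<Rightarrow> int) \<Rightarrow> bool" where
  "bounded_degree f \<longleftrightarrow> (\<exists>d. \<forall>\<alpha>. f \<alpha> \<noteq> 0 \<longrightarrow> mdeg \<alpha> \<le> d)"

lemma bounded_degreeI: "(\<And>\<alpha>. f \<alpha> \<noteq> 0 \<Longrightarrow> mdeg \<alpha> \<le> d) \<Longrightarrow> bounded_degree f"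
  by (auto simp: bounded_degree_def)

typedef bseries = "{f :: (nat \<Rightarrow>\<^sub>0 nat) \<Rightarrow> int. bounded_degree f}"
  morphisms coeff_of Abs_bseries
  by (rule exI[of _ "\<lambda>_. 0"]) (simp add: bounded_degree_def)

setup_lifting type_definition_bseries

lemma bseries_eqI: "(\<And>\<alpha>. coeff_of f \<alpha> = coeff_of g \<alpha>) \<Longrightarrow> f = g"
  by (simp add: coeff_of_inject[symmetric] fun_eq_iff)

instantiation bseries :: comm_ring_1
begin

lift_definition zero_bseries :: bseries is "\<lambda>_. 0"
  by (rule bounded_degreeI[of _ 0]) simp

lift_definition one_bseries :: bseries is "\<lambda>\<alpha>. if \<alpha> = 0 then 1 else 0"
  by (rule bounded_degreeI[of _ 0]) (auto split: if_splits)

lift_definition uminus_bseries :: "bseries \<Rightarrow> bseries" is "\<lambda>f \<alpha>. - f \<alpha>"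
  by (simp add: bounded_degree_def)

lift_definition plus_bseries :: "bseries \<Rightarrow> bseries \<Rightarrow> bseries" is "\<lambda>f g \<alpha>. f \<alpha> + g \<alpha>"
proof -
  fix f g :: "(nat \<Rightarrow>\<^sub>0 nat) \<Rightarrow> int"
  assume "bounded_degree f" "bounded_degree g"
  then obtain d e where "\<And>\<alpha>. f \<alpha> \<noteq> 0 \<Longrightarrow> mdeg \<alpha> \<le> d" "\<And>\<alpha>. g \<alpha> \<noteq> 0 \<Longrightarrow> mdeg \<alpha> \<le> e"
    unfolding bounded_degree_def by blast
  then show "bounded_degree (\<lambda>\<alpha>. f \<alpha> + g \<alpha>)"
    by (intro bounded_degreeI[of _ "max d e"]) (metis add.right_neutral le_max_iff_disj)
qed

lift_definition minus_bseries :: "bseries \<Rightarrow> bseries \<Rightarrow> bseries" is "\<lambda>f g \<alpha>. f \<alpha> - g \<alpha>"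
proof -
  fix f g :: "(nat \<Rightarrow>\<^sub>0 nat) \<Rightarrow> int"
  assume "bounded_degree f" "bounded_degree g"
  then obtain d e where "\<And>\<alpha>. f \<alpha> \<noteq> 0 \<Longrightarrow> mdeg \<alpha> \<le> d" "\<And>\<alpha>. g \<alpha> \<noteq> 0 \<Longrightarrow> mdeg \<alpha> \<le> e"
    unfolding bounded_degree_def by blast
  then show "bounded_degree (\<lambda>\<alpha>. f \<alpha> - g \<alpha>)"
    by (intro bounded_degreeI[of _ "max d e"]) (metis diff_zero le_max_iff_disj)
qed

lift_definition times_bseries :: "bseries \<Rightarrow> bseries \<Rightarrow> bseries" is
  "\<lambda>f g \<alpha>. \<Sum>(\<beta>, \<delta>)\<in>splits \<alpha>. f \<beta> * g \<delta>"
proof -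
  fix f g :: "(nat \<Rightarrow>\<^sub>0 nat) \<Rightarrow> int"
  assume "bounded_degree f" "bounded_degree g"
  then obtain d e where de: "\<And>\<alpha>. f \<alpha> \<noteq> 0 \<Longrightarrow> mdeg \<alpha> \<le> d" "\<And>\<alpha>. g \<alpha> \<noteq> 0 \<Longrightarrow> mdeg \<alpha> \<le> e"
    unfolding bounded_degree_def by blast
  show "bounded_degree (\<lambda>\<alpha>. \<Sum>(\<beta>, \<delta>)\<in>splits \<alpha>. f \<beta> * g \<delta>)"
  proof (rule bounded_degreeI[of _ "d + e"])
    fix \<alpha>
    assume "(\<Sum>(\<beta>, \<delta>)\<in>splits \<alpha>. f \<beta> * g \<delta>) \<noteq> 0"
    then obtain p where "p \<in> splits \<alpha>" "(case p of (\<beta>, \<delta>) \<Rightarrow> f \<beta> * g \<delta>) \<noteq> 0"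
      by (rule sum.not_neutral_contains_not_neutral)
    then obtain \<beta> \<delta> where "\<alpha> = \<beta> + \<delta>" "f \<beta> \<noteq> 0" "g \<delta> \<noteq> 0"
      by (auto simp: splits_def)
    then show "mdeg \<alpha> \<le> d + e"
      using de by (simp add: add_mono)
  qed
qed

instance
proof
  fix f g h :: bseries
  show "f * g * h = f * (g * h)"
  proof (rule bseries_eqI)
    fix \<alpha>
    have "coeff_of (f * g * h) \<alpha>
        = (\<Sum>(p, q)\<in>Sigma (splits \<alpha>) (\<lambda>(\<beta>, \<delta>). splits \<beta>).
             coeff_of f (fst q) * coeff_of g (snd q) * coeff_of h (snd p))"
      by (simp add: times_bseries.rep_eq sum_distrib_right case_prod_unfold sum.Sigma)
    also have "\<dots> = (\<Sum>(p, q)\<in>Sigma (splits \<alpha>) (\<lambda>(\<beta>, \<delta>). splits \<delta>).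
             coeff_of f (fst p) * (coeff_of g (fst q) * coeff_of h (snd q)))"
      by (rule sum.reindex_bij_witness
          [of _ "\<lambda>((a, p), (b, c)). ((a + b, c), (a, b))" "\<lambda>((p, c), (a, b)). ((a, b + c), (b, c))"])
        (auto simp: splits_def add.assoc mult.assoc)
    also have "\<dots> = coeff_of (f * (g * h)) \<alpha>"
      by (simp add: times_bseries.rep_eq sum_distrib_left case_prod_unfold sum.Sigma)
    finally show "coeff_of (f * g * h) \<alpha> = coeff_of (f * (g * h)) \<alpha>" .
  qed
  show "f * g = g * f"
  proof (rule bseries_eqI)
    fix \<alpha>
    show "coeff_of (f * g) \<alpha> = coeff_of (g * f) \<alpha>"
      unfolding times_bseries.rep_eq
      by (rule sum.reindex_bij_witness[of _ prod.swap prod.swap])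
        (auto simp: splits_def add.commute)
  qed
  show "1 * f = f"
  proof (rule bseries_eqI)
    fix \<alpha>
    have "coeff_of (1 * f) \<alpha> = (\<Sum>(\<beta>, \<delta>)\<in>{(0, \<alpha>)}. coeff_of 1 \<beta> * coeff_of f \<delta>)"
      unfolding times_bseries.rep_eq
      by (rule sum.mono_neutral_right, rule finite_splits)
        (auto simp: splits_def one_bseries.rep_eq split: if_splits)
    then show "coeff_of (1 * f) \<alpha> = coeff_of f \<alpha>"
      by (simp add: one_bseries.rep_eq)
  qed
  show "(f + g) * h = f * h + g * h"
    by (rule bseries_eqI)
      (simp add: times_bseries.rep_eq plus_bseries.rep_eq case_prod_unfold distrib_right
        sum.distrib)
  show "f + g + h = f + (g + h)" "f + g = g + f" "0 + f = f" "- f + f = 0" "f - g = f + - g"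
    by (rule bseries_eqI, simp add: plus_bseries.rep_eq zero_bseries.rep_eq
        uminus_bseries.rep_eq minus_bseries.rep_eq)+
  have "coeff_of 0 0 \<noteq> coeff_of 1 0"
    by (simp add: zero_bseries.rep_eq one_bseries.rep_eq)
  then show "(0 :: bseries) \<noteq> 1"
    by metis
qed

end

text \<open>
  The coefficient function of the formal sum \<open>\<Sum>\<^sub>i\<^sub>\<in>\<^sub>I t\<^bsup>e i\<^esup>\<close> of a possibly infinite family of
  monomials. It is the intended one only if every monomial occurs finitely often (\<^const>\<open>card\<close> of an
  infinite set is \<open>0\<close>); for positive exponents this is the case in all uses below, see the
  finiteness lemmas.
\<close>

definition formal_sum_coeff ::
    "'i set \<Rightarrow> ('i \<Rightarrow> (nat \<Rightarrow>\<^sub>0 nat)) \<Rightarrow> (nat \<Rightarrow>\<^sub>0 nat) \<Rightarrow> int" where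
  "formal_sum_coeff I e \<alpha> = int (card {i \<in> I. e i = \<alpha>})"

lemma bounded_degree_formal_sum_coeff:
  assumes "\<And>i. i \<in> I \<Longrightarrow> mdeg (e i) \<le> d"
  shows "bounded_degree (formal_sum_coeff I e)"
proof (rule bounded_degreeI[of _ d])
  fix \<alpha>
  assume "formal_sum_coeff I e \<alpha> \<noteq> 0"
  then have "{i \<in> I. e i = \<alpha>} \<noteq> {}"
    unfolding formal_sum_coeff_def by (metis card.empty of_nat_0)
  then show "mdeg \<alpha> \<le> d"
    using assms by auto
qed


section \<open>Monomial and essential quasi-symmetric functions\<close>

definition seq_monomial :: "nat list \<Rightarrow> nat list \<Rightarrow> (nat \<Rightarrow>\<^sub>0 nat)" where
  "seq_monomial \<gamma> m = (\<Sum>k<length \<gamma>. Poly_Mapping.single (m ! k) (\<gamma> ! k))"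

lemma mdeg_seq_monomial: "mdeg (seq_monomial \<gamma> m) = (\<Sum>k<length \<gamma>. \<gamma> ! k)"
  by (simp add: seq_monomial_def)

lift_definition monomial_qsym :: "nat list \<Rightarrow> bseries" is
  "\<lambda>\<gamma>. formal_sum_coeff
     {m. length m = length \<gamma> \<and> set m \<subseteq> {1..} \<and> sorted_wrt (<) m} (seq_monomial \<gamma>)"
  by (rule bounded_degree_formal_sum_coeff, rule eq_refl, rule mdeg_seq_monomial)

lift_definition essential_qsym :: "nat list \<Rightarrow> bseries" is
  "\<lambda>\<gamma>. formal_sum_coeff
     {m. length m = length \<gamma> \<and> set m \<subseteq> {1..} \<and> sorted_wrt (\<le>) m} (seq_monomial \<gamma>)"
  by (rule bounded_degree_formal_sum_coeff, rule eq_refl, rule mdeg_seq_monomial)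

lemma lookup_sum_single_pos:
  assumes "finite X" "x \<in> X" "(e x :: nat) > 0"
  shows "m x \<in> Poly_Mapping.keys (\<Sum>x\<in>X. Poly_Mapping.single (m x) (e x))"
proof -
  have "e x \<le> (\<Sum>y\<in>X. Poly_Mapping.lookup (Poly_Mapping.single (m y) (e y)) (m x))"
    using member_le_sum[OF assms(2), of "\<lambda>y. Poly_Mapping.lookup (Poly_Mapping.single (m y) (e y)) (m x)"]
      assms(1) by simp
  then show ?thesis
    using assms(3) by (simp add: in_keys_iff lookup_sum)
qed

lemma finite_seq_monomial_fiber:
  assumes "\<forall>g \<in> set \<gamma>. g > 0"
  shows "finite {m. length m = length \<gamma> \<and> seq_monomial \<gamma> m = \<alpha>}"
proof (rule finite_subset)
  show "{m :: nat list. length m = length \<gamma> \<and> seq_monomial \<gamma> m = \<alpha>}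
      \<subseteq> {m :: nat list. set m \<subseteq> Poly_Mapping.keys \<alpha> \<and> length m = length \<gamma>}"
  proof clarify
    fix m :: "nat list" and x
    assume m: "length m = length \<gamma>" "x \<in> set m"
    then obtain k where k: "k < length \<gamma>" "x = m ! k"
      by (metis in_set_conv_nth)
    then show "x \<in> Poly_Mapping.keys (seq_monomial \<gamma> m)"
      using lookup_sum_single_pos[of "{..<length \<gamma>}" k "(!) \<gamma>" "(!) m"] assms
      by (simp add: seq_monomial_def)
  qed
qed (simp add: finite_lists_length_eq)


section \<open>Partitions, skew diagrams and tableaux\<close>

text \<open>
  A partition \<open>(\<lambda>\<^sub>1, \<dots>, \<lambda>\<^sub>r)\<close>, zero parts allowed, is a weakly decreasing list of length \<open>r\<close>.
  Parts, rows and columns are numbered from \<open>1\<close>.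
\<close>

definition is_partition :: "nat list \<Rightarrow> bool" where
  "is_partition lam \<longleftrightarrow> sorted_wrt (\<ge>) lam"

definition part :: "nat list \<Rightarrow> nat \<Rightarrow> nat" where
  "part lam i = (if 1 \<le> i \<and> i \<le> length lam then lam ! (i - 1) else 0)"

definition conj_part :: "nat list \<Rightarrow> nat \<Rightarrow> nat" where
  "conj_part lam i = card {j \<in> {1..length lam}. part lam j \<ge> i}"

definition diagram :: "nat list \<Rightarrow> (nat \<times> nat) set" where
  "diagram lam = {(i, j). 1 \<le> i \<and> i \<le> length lam \<and> 1 \<le> j \<and> j \<le> part lam i}"

definition skew_diagram :: "nat list \<Rightarrow> nat list \<Rightarrow> (nat \<times> nat) set" where
  "skew_diagram lam mu = diagram lam - diagram mu"

lemma finite_skew_diagram [simp]: "finite (skew_diagram lam mu)"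
proof (rule finite_subset)
  show "skew_diagram lam mu \<subseteq> Sigma {1..length lam} (\<lambda>i. {1..part lam i})"
    by (auto simp: skew_diagram_def diagram_def)
qed auto

definition fillings :: "nat list \<Rightarrow> nat list \<Rightarrow> 'x set \<Rightarrow> (nat \<times> nat \<Rightarrow> 'x) set" where
  "fillings lam mu X = skew_diagram lam mu \<rightarrow>\<^sub>E X"

definition diag_fillings :: "nat list \<Rightarrow> nat list \<Rightarrow> 'x set \<Rightarrow> (nat \<times> nat \<Rightarrow> 'x) set" where
  "diag_fillings lam mu X = {t \<in> fillings lam mu X.
     \<forall>(i, j) \<in> skew_diagram lam mu. \<forall>(k, l) \<in> skew_diagram lam mu.
       int j - int i = int l - int k \<longrightarrow> t (i, j) = t (k, l)}"

definition SSYT :: "nat list \<Rightarrow> nat list \<Rightarrow> (nat \<times> nat \<Rightarrow> nat) set" where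
  "SSYT lam mu = {m \<in> fillings lam mu {1..}.
     (\<forall>i j l. (i, j) \<in> skew_diagram lam mu \<longrightarrow> (i, l) \<in> skew_diagram lam mu \<longrightarrow> j < l
        \<longrightarrow> m (i, j) \<le> m (i, l)) \<and>
     (\<forall>i j k. (i, j) \<in> skew_diagram lam mu \<longrightarrow> (k, j) \<in> skew_diagram lam mu \<longrightarrow> i < k
        \<longrightarrow> m (i, j) < m (k, j))}"

definition tableau_monomial ::
    "nat list \<Rightarrow> nat list \<Rightarrow> (nat \<times> nat \<Rightarrow> nat) \<Rightarrow> (nat \<times> nat \<Rightarrow> nat) \<Rightarrow> (nat \<Rightarrow>\<^sub>0 nat)" where
  "tableau_monomial lam mu \<gamma> m =
     (\<Sum>x\<in>skew_diagram lam mu. Poly_Mapping.single (m x) (\<gamma> x))"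

lemma mdeg_tableau_monomial:
  "mdeg (tableau_monomial lam mu \<gamma> m) = (\<Sum>x\<in>skew_diagram lam mu. \<gamma> x)"
  by (simp add: tableau_monomial_def)

lift_definition schur_qsym :: "nat list \<Rightarrow> nat list \<Rightarrow> (nat \<times> nat \<Rightarrow> nat) \<Rightarrow> bseries" is
  "\<lambda>lam mu \<gamma>. formal_sum_coeff (SSYT lam mu) (tableau_monomial lam mu \<gamma>)"
  by (rule bounded_degree_formal_sum_coeff, rule eq_refl, rule mdeg_tableau_monomial)

lemma finite_tableau_monomial_fiber:
  assumes "\<gamma> \<in> fillings lam mu {1..}"
  shows "finite {m \<in> SSYT lam mu. tableau_monomial lam mu \<gamma> m = \<alpha>}"
proof (rule finite_subset)
  show "{m \<in> SSYT lam mu. tableau_monomial lam mu \<gamma> m = \<alpha>}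
      \<subseteq> skew_diagram lam mu \<rightarrow>\<^sub>E Poly_Mapping.keys \<alpha>"
  proof clarify
    fix m
    assume m: "m \<in> SSYT lam mu"
    then have "m \<in> skew_diagram lam mu \<rightarrow>\<^sub>E {1..}"
      by (simp add: SSYT_def fillings_def)
    moreover have "m x \<in> Poly_Mapping.keys (tableau_monomial lam mu \<gamma> m)"
      if "x \<in> skew_diagram lam mu" for x
    proof -
      have "\<gamma> x \<in> {1..}"
        using assms that unfolding fillings_def by (rule PiE_mem)
      then show ?thesis
        using lookup_sum_single_pos[of "skew_diagram lam mu" x \<gamma> m] that
        by (simp add: tableau_monomial_def)
    qed
    ultimately show "m \<in> skew_diagram lam mu \<rightarrow>\<^sub>E Poly_Mapping.keys (tableau_monomial lam mu \<gamma> m)"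
      by (auto simp: PiE_iff)
  qed
qed (auto intro: finite_PiE)

end

theory Submission
  imports Defs
begin

text \<open>
  Both identities say that two families of series satisfy the same recursion in the number of
  variables. After setting \<open>t\<^sub>m = 0\<close> for \<open>m > N\<close> everything becomes a finite sum, and the
  only fact about the exponents that matters is that the weight of an entry \<open>m\<close> in a cell depends on
  \<open>m\<close> and on the content of the cell. So the weights may be arbitrary elements \<open>x m k\<close> of a commutative
  ring, indexed by entries \<open>m\<close> and contents \<open>k\<close>.

  On the tableau side, erase the cells with the largest entry \<open>N + 1\<close>. A tableau with entries at most
  \<open>N\<close> of some intermediate shape \<open>v\<close> remains, and the erased cells form a strip: no two of them lie in
  the same line of the direction in which entries increase strictly (\<open>tab_sum_Suc\<close>).

  On the determinant side, a diagram row with contents \<open>a + 1, \<dots>, b\<close> is filled by an increasing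
  sequence, and erasing the largest entry leaves the contents \<open>a + 1, \<dots>, v\<close>. The start \<open>a\<close> depends only
  on the matrix column and the end \<open>b\<close> only on the matrix row; this is where constancy along diagonals
  is needed. So every matrix row for \<open>N + 1\<close> variables is a linear combination, with coefficients
  independent of the matrix column, of rows for \<open>N\<close> variables with other ends \<open>v\<close>, and the
  determinant expands by multilinearity. It remains to see that only strips survive.

  For strictly increasing sequences at most one cell is erased, so the end of row \<open>i\<close> stays or moves by
  one. A choice of ends that does not give a partition shape has two equal rows, so its determinant is
  zero. For weakly increasing sequences any number of cells may be erased. Subtracting from
  row \<open>i\<close> the right multiple of row \<open>i + 1\<close> removes exactly the terms in which row \<open>i\<close> becomes shorter
  than the original row \<open>i + 1\<close>, and what is left are the horizontal strips. With no variables at all,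
  both sides test whether the inner and the outer shape agree. This gives \<open>jacobi_trudi_complete_sum\<close>
  and \<open>jacobi_trudi_elementary_sum\<close>; the case of a single row identifies the entries of the
  matrices with essential and monomial quasi-symmetric functions.

  The determinant of essential functions is obtained by reading the diagram by rows. The determinant of
  monomial functions is obtained by reading it by columns, which exchanges the two kinds of monotonicity
  and negates contents. Truncation to \<open>N\<close> variables is a ring homomorphism, hence commutes with
  determinants, and a series is determined by its truncations.
\<close>

section \<open>Tableaux with weights depending on entry and content\<close>

text \<open>
  Rows are numbered from \<open>0\<close>, and row \<open>i\<close> occupies the columns \<open>p i + 1, \<dots>, q i\<close>. Integer bounds let
  a content \<open>j - i\<close> be used as a position without truncated subtraction.
\<close>
definition cells :: "nat \<Rightarrow> (nat \<Rightarrow> int) \<Rightarrow> (nat \<Rightarrow> int) \<Rightarrow> (nat \<times> int) set" where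
  "cells n p q = Sigma {..<n} (\<lambda>i. {p i<..q i})"

lemma mem_cells [simp]: "(i, j) \<in> cells n p q \<longleftrightarrow> i < n \<and> p i < j \<and> j \<le> q i"
  by (auto simp: cells_def)

lemma finite_cells [simp]: "finite (cells n p q)"
  by (simp add: cells_def)

text \<open>
  \<open>R\<close> relates entries along rows and \<open>C\<close> along columns. Taking one of them to be \<open>\<le>\<close> and the other to be
  \<open><\<close> gives semi-standard tableaux and their transposes.
\<close>
definition tabs ::
    "(nat \<Rightarrow> nat \<Rightarrow> bool) \<Rightarrow> (nat \<Rightarrow> nat \<Rightarrow> bool) \<Rightarrow> nat \<Rightarrow> (nat \<Rightarrow> int) \<Rightarrow> (nat \<Rightarrow> int) \<Rightarrow> nat
      \<Rightarrow> (nat \<times> int \<Rightarrow> nat) set" where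
  "tabs R C n p q N = {T \<in> cells n p q \<rightarrow>\<^sub>E {1..N}.
     (\<forall>i j l. (i, j) \<in> cells n p q \<longrightarrow> (i, l) \<in> cells n p q \<longrightarrow> j < l \<longrightarrow> R (T (i, j)) (T (i, l))) \<and>
     (\<forall>i k j. (i, j) \<in> cells n p q \<longrightarrow> (k, j) \<in> cells n p q \<longrightarrow> i < k \<longrightarrow> C (T (i, j)) (T (k, j)))}"

lemma finite_tabs [simp]: "finite (tabs R C n p q N)"
  by (rule finite_subset[of _ "cells n p q \<rightarrow>\<^sub>E {1..N}"]) (auto simp: tabs_def intro: finite_PiE)

definition tab_sum ::
    "(nat \<Rightarrow> nat \<Rightarrow> bool) \<Rightarrow> (nat \<Rightarrow> nat \<Rightarrow> bool) \<Rightarrow> (nat \<Rightarrow> int \<Rightarrow> 'a :: comm_ring_1)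
      \<Rightarrow> nat \<Rightarrow> (nat \<Rightarrow> int) \<Rightarrow> (nat \<Rightarrow> int) \<Rightarrow> nat \<Rightarrow> 'a" where
  "tab_sum R C x n p q N = (\<Sum>T\<in>tabs R C n p q N. \<Prod>(i, j)\<in>cells n p q. x (T (i, j)) (j - int i))"

text \<open>
  The weight of equal entries in cells of contents \<open>a + 1, \<dots>, b\<close>.
\<close>
definition run_weight :: "(int \<Rightarrow> 'a :: comm_ring_1) \<Rightarrow> int \<Rightarrow> int \<Rightarrow> 'a" where
  "run_weight y a b = (\<Prod>k\<in>{a<..b}. y k)"

lemma run_weight_mult:
  assumes "a \<le> b" "b \<le> d"
  shows "run_weight y a d = run_weight y a b * run_weight y b d"
proof -
  have "{a<..d} = {a<..b} \<union> {b<..d}" using assms by auto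
  then show ?thesis unfolding run_weight_def by (simp add: prod.union_disjoint)
qed

definition decreasing :: "nat \<Rightarrow> (nat \<Rightarrow> int) \<Rightarrow> bool" where
  "decreasing n v \<longleftrightarrow> (\<forall>i k. i < k \<longrightarrow> k < n \<longrightarrow> v k \<le> v i)"

lemma decreasingD: "decreasing n v \<Longrightarrow> i \<le> k \<Longrightarrow> k < n \<Longrightarrow> v k \<le> v i"
  by (cases "i = k") (auto simp: decreasing_def)

lemma decreasing_SucI:
  assumes "\<And>i. Suc i < n \<Longrightarrow> v (Suc i) \<le> v i"
  shows "decreasing n v"
  unfolding decreasing_def
proof (intro allI impI)
  fix i k :: nat
  assume "i < k" "k < n"
  then show "v k \<le> v i"
  proof (induction k)
    case (Suc k)
    then show ?case using assms[of k] by (cases "i = k") auto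
  qed simp
qed

text \<open>
  The shapes \<open>v\<close> between \<open>p\<close> and \<open>q\<close> for which the cells of \<open>q\<close> outside \<open>v\<close> may all carry the same entry
  \<open>M\<close>. A reflexive \<open>R\<close> or \<open>C\<close> imposes no restriction in its direction; an irreflexive one forbids two
  such cells in a common line.
\<close>
definition strips ::
    "(nat \<Rightarrow> nat \<Rightarrow> bool) \<Rightarrow> (nat \<Rightarrow> nat \<Rightarrow> bool) \<Rightarrow> nat \<Rightarrow> (nat \<Rightarrow> int) \<Rightarrow> (nat \<Rightarrow> int) \<Rightarrow> nat
      \<Rightarrow> (nat \<Rightarrow> int) set" where
  "strips R C n p q M = {v \<in> (\<Pi>\<^sub>E i\<in>{..<n}. {p i..q i}). decreasing n v \<and>
     (\<forall>i j l. (i, j) \<in> cells n v q \<longrightarrow> (i, l) \<in> cells n v q \<longrightarrow> j < l \<longrightarrow> R M M) \<and>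
     (\<forall>i k j. (i, j) \<in> cells n v q \<longrightarrow> (k, j) \<in> cells n v q \<longrightarrow> i < k \<longrightarrow> C M M)}"

lemma finite_strips [simp]: "finite (strips R C n p q M)"
  by (rule finite_subset[of _ "\<Pi>\<^sub>E i\<in>{..<n}. {p i..q i}"]) (auto simp: strips_def intro: finite_PiE)

lemma finite_int_interval_Collect [simp]: "finite {j :: int. a < j \<and> j \<le> b \<and> P j}"
  by (rule finite_subset[of _ "{a<..b}"]) auto

text \<open>
  The shape formed by the entries that are at most \<open>N\<close>. Inserting \<open>p i\<close> covers the rows without
  such entries.
\<close>
definition profile :: "nat \<Rightarrow> (nat \<Rightarrow> int) \<Rightarrow> (nat \<Rightarrow> int) \<Rightarrow> nat \<Rightarrow> (nat \<times> int \<Rightarrow> nat) \<Rightarrow> nat \<Rightarrow> int" where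
  "profile n p q N T = (\<lambda>i\<in>{..<n}. Max (insert (p i) {j \<in> {p i<..q i}. T (i, j) \<le> N}))"

definition extend :: "nat \<Rightarrow> (nat \<Rightarrow> int) \<Rightarrow> (nat \<Rightarrow> int) \<Rightarrow> (nat \<Rightarrow> int) \<Rightarrow> nat
    \<Rightarrow> (nat \<times> int \<Rightarrow> nat) \<Rightarrow> nat \<times> int \<Rightarrow> nat" where
  "extend n p q v M T = (\<lambda>z\<in>cells n p q. if z \<in> cells n p v then T z else M)"

lemma tabsD:
  assumes "T \<in> tabs R C n p q N"
  shows "T \<in> cells n p q \<rightarrow>\<^sub>E {1..N}"
    and "(i, j) \<in> cells n p q \<Longrightarrow> (i, l) \<in> cells n p q \<Longrightarrow> j < l \<Longrightarrow> R (T (i, j)) (T (i, l))"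
    and "(i, j) \<in> cells n p q \<Longrightarrow> (k, j) \<in> cells n p q \<Longrightarrow> i < k \<Longrightarrow> C (T (i, j)) (T (k, j))"
  using assms unfolding tabs_def by blast+

lemma stripsD:
  assumes "v \<in> strips R C n p q M"
  shows "v \<in> (\<Pi>\<^sub>E i\<in>{..<n}. {p i..q i})" "decreasing n v"
    "i < n \<Longrightarrow> p i \<le> v i" "i < n \<Longrightarrow> v i \<le> q i"
  using assms unfolding strips_def by (auto simp: PiE_iff)

section \<open>Erasing the largest entry\<close>

context
  fixes R C :: "nat \<Rightarrow> nat \<Rightarrow> bool" and n :: nat and p q :: "nat \<Rightarrow> int"
  assumes R_less: "\<And>a b. a < b \<Longrightarrow> R a b" and R_le: "\<And>a b. R a b \<Longrightarrow> a \<le> b"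
    and C_less: "\<And>a b. a < b \<Longrightarrow> C a b" and C_le: "\<And>a b. C a b \<Longrightarrow> a \<le> b"
    and p: "decreasing n p" and q: "decreasing n q" and pq: "\<And>i. i < n \<Longrightarrow> p i \<le> q i"
begin

lemma profile_bounds:
  assumes "i < n"
  shows "p i \<le> profile n p q N T i" "profile n p q N T i \<le> q i"
proof -
  let ?D = "{j \<in> {p i<..q i}. T (i, j) \<le> N}"
  have "Max (insert (p i) ?D) \<in> insert (p i) ?D" by (rule Max_in) auto
  then show "profile n p q N T i \<le> q i" using pq[OF assms] assms by (auto simp: profile_def)
  show "p i \<le> profile n p q N T i" using assms by (auto simp: profile_def intro!: Max_ge)
qed

lemma le_profile_iff:
  assumes T: "T \<in> tabs R C n p q M" and ij: "(i, j) \<in> cells n p q"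
  shows "j \<le> profile n p q N T i \<longleftrightarrow> T (i, j) \<le> N"
proof -
  let ?D = "{j \<in> {p i<..q i}. T (i, j) \<le> N}"
  have eq: "profile n p q N T i = Max (insert (p i) ?D)" using ij by (simp add: profile_def)
  have "Max (insert (p i) ?D) \<in> insert (p i) ?D" by (rule Max_in) auto
  moreover have "T (i, j) \<le> N" if "l \<in> ?D" "j \<le> l" for l
  proof (cases "j = l")
    case False
    then have "R (T (i, j)) (T (i, l))" using that ij by (intro tabsD(2)[OF T]) auto
    then show ?thesis using R_le that by fastforce
  qed (use that in simp)
  ultimately have "T (i, j) \<le> N" if "j \<le> Max (insert (p i) ?D)"
    using that ij by (metis (no_types, lifting) insert_iff leD mem_cells)
  moreover have "j \<le> Max (insert (p i) ?D)" if "T (i, j) \<le> N"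
    using that ij by (intro Max_ge) auto
  ultimately show ?thesis unfolding eq by blast
qed

lemma profile_decreasing:
  assumes T: "T \<in> tabs R C n p q M"
  shows "decreasing n (profile n p q N T)"
  unfolding decreasing_def
proof (intro allI impI)
  fix i k assume ik: "i < k" "k < n"
  let ?v = "profile n p q N T"
  have pi: "p k \<le> p i" "q k \<le> q i" using p q ik by (auto intro: decreasingD)
  show "?v k \<le> ?v i"
  proof (cases "?v k \<le> p i")
    case True
    then show ?thesis using profile_bounds[of i N T] ik by simp
  next
    case False
    have k: "(k, ?v k) \<in> cells n p q" and i: "(i, ?v k) \<in> cells n p q"
      using False pi ik profile_bounds(2)[of k N T] by auto
    have "C (T (i, ?v k)) (T (k, ?v k))" by (rule tabsD(3)[OF T i k ik(1)])
    moreover have "T (k, ?v k) \<le> N" using le_profile_iff[OF T k] by blast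
    ultimately have "T (i, ?v k) \<le> N" using C_le le_trans by blast
    then show ?thesis using le_profile_iff[OF T i] by blast
  qed
qed

text \<open>
  This is why the erased cells form a strip: they all carry the single value \<open>N + 1\<close>.
\<close>
lemma entry_outside_profile:
  assumes T: "T \<in> tabs R C n p q (Suc N)" and "(i, j) \<in> cells n (profile n p q N T) q"
  shows "(i, j) \<in> cells n p q" "T (i, j) = Suc N"
proof -
  show c: "(i, j) \<in> cells n p q" using assms profile_bounds[of i N T] by auto
  have "\<not> T (i, j) \<le> N" using le_profile_iff[OF T c, of N] assms by auto
  moreover have "T (i, j) \<in> {1..Suc N}" by (rule PiE_mem[OF tabsD(1)[OF T] c])
  ultimately show "T (i, j) = Suc N" by simp
qed

lemma profile_in_strips:
  assumes T: "T \<in> tabs R C n p q (Suc N)"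
  shows "profile n p q N T \<in> strips R C n p q (Suc N)"
proof -
  let ?v = "profile n p q N T"
  have "?v \<in> (\<Pi>\<^sub>E i\<in>{..<n}. {p i..q i})"
    using profile_bounds[of _ N T] by (simp add: PiE_iff) (simp add: profile_def)
  moreover have "R (Suc N) (Suc N)"
    if "(i, j) \<in> cells n ?v q" "(i, l) \<in> cells n ?v q" "j < l" for i j l
    using entry_outside_profile[OF T that(1)] entry_outside_profile[OF T that(2)]
      tabsD(2)[OF T, of i j l] that(3) by metis
  moreover have "C (Suc N) (Suc N)"
    if "(i, j) \<in> cells n ?v q" "(k, j) \<in> cells n ?v q" "i < k" for i j k
    using entry_outside_profile[OF T that(1)] entry_outside_profile[OF T that(2)]
      tabsD(3)[OF T, of i j k] that(3) by metis
  ultimately show ?thesis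
    using profile_decreasing[OF T] unfolding strips_def by blast
qed

lemma restrict_in_tabs:
  assumes T: "T \<in> tabs R C n p q (Suc N)"
  shows "restrict T (cells n p (profile n p q N T)) \<in> tabs R C n p (profile n p q N T) N"
proof -
  let ?v = "profile n p q N T"
  have sub: "(i, j) \<in> cells n p q" "T (i, j) \<in> {1..N}" if "(i, j) \<in> cells n p ?v" for i j
  proof -
    show c: "(i, j) \<in> cells n p q" using that profile_bounds[of i N T] by auto
    show "T (i, j) \<in> {1..N}"
      using le_profile_iff[OF T c, of N] that PiE_mem[OF tabsD(1)[OF T] c] by auto
  qed
  have "restrict T (cells n p ?v) \<in> cells n p ?v \<rightarrow>\<^sub>E {1..N}"
    using sub(2) by (intro restrict_PiE_iff[THEN iffD2] ballI) (metis surj_pair)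
  moreover have "R (T (i, j)) (T (i, l))"
    if "(i, j) \<in> cells n p ?v" "(i, l) \<in> cells n p ?v" "j < l" for i j l
    by (rule tabsD(2)[OF T sub(1)[OF that(1)] sub(1)[OF that(2)] that(3)])
  moreover have "C (T (i, j)) (T (k, j))"
    if "(i, j) \<in> cells n p ?v" "(k, j) \<in> cells n p ?v" "i < k" for i j k
    by (rule tabsD(3)[OF T sub(1)[OF that(1)] sub(1)[OF that(2)] that(3)])
  ultimately show ?thesis
    unfolding tabs_def by (simp del: mem_cells)
qed

lemma extend_in_tabs:
  assumes v: "v \<in> strips R C n p q (Suc N)" and T: "T \<in> tabs R C n p v N"
  shows "extend n p q v (Suc N) T \<in> tabs R C n p q (Suc N)"
proof -
  let ?E = "extend n p q v (Suc N) T"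
  have bd: "p i \<le> v i" "v i \<le> q i" if "i < n" for i using stripsD[OF v] that by auto
  have val: "?E z = T z" "T z \<le> N" "1 \<le> T z" if "z \<in> cells n p v" for z
  proof -
    have "z \<in> cells n p q" using that bd by (cases z) force
    then show "?E z = T z" using that by (simp add: extend_def)
    have "T z \<in> {1..N}" by (rule PiE_mem[OF tabsD(1)[OF T] that])
    then show "T z \<le> N" "1 \<le> T z" by auto
  qed
  have val': "?E z = Suc N" if "z \<in> cells n p q" "z \<notin> cells n p v" for z
    using that by (simp add: extend_def)
  have "?E \<in> cells n p q \<rightarrow>\<^sub>E {1..Suc N}"
    unfolding extend_def using val by (intro restrict_PiE_iff[THEN iffD2] ballI) force
  moreover have "R (?E (i, j)) (?E (i, l))"
    if c: "(i, j) \<in> cells n p q" "(i, l) \<in> cells n p q" "j < l" for i j l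
  proof (cases "(i, l) \<in> cells n p v")
    case True
    then have "(i, j) \<in> cells n p v" using c by auto
    then show ?thesis using tabsD(2)[OF T] True val c by simp
  next
    case False
    show ?thesis
    proof (cases "(i, j) \<in> cells n p v")
      case True
      then show ?thesis using val[OF True] val'[OF c(2) False] by (auto intro: R_less)
    next
      case 2: False
      have "(i, j) \<in> cells n v q" "(i, l) \<in> cells n v q" using c False 2 by auto
      then have "R (Suc N) (Suc N)" using v \<open>j < l\<close> unfolding strips_def by blast
      then show ?thesis using val'[OF c(1) 2] val'[OF c(2) False] by simp
    qed
  qed
  moreover have "C (?E (i, j)) (?E (k, j))"
    if c: "(i, j) \<in> cells n p q" "(k, j) \<in> cells n p q" "i < k" for i j k
  proof (cases "(k, j) \<in> cells n p v")
    case True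
    then have "(i, j) \<in> cells n p v"
      using c decreasingD[OF stripsD(2)[OF v], of i k] by auto
    then show ?thesis using tabsD(3)[OF T] True val c by simp
  next
    case False
    show ?thesis
    proof (cases "(i, j) \<in> cells n p v")
      case True
      then show ?thesis using val[OF True] val'[OF c(2) False] by (auto intro: C_less)
    next
      case 2: False
      have "(i, j) \<in> cells n v q" "(k, j) \<in> cells n v q" using c False 2 by auto
      then have "C (Suc N) (Suc N)" using v \<open>i < k\<close> unfolding strips_def by blast
      then show ?thesis using val'[OF c(1) 2] val'[OF c(2) False] by simp
    qed
  qed
  ultimately show ?thesis unfolding tabs_def by blast
qed

lemma extend_restrict:
  assumes T: "T \<in> tabs R C n p q (Suc N)"
  shows "extend n p q (profile n p q N T) (Suc N) (restrict T (cells n p (profile n p q N T))) = T"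
proof
  fix z
  show "extend n p q (profile n p q N T) (Suc N) (restrict T (cells n p (profile n p q N T))) z = T z"
  proof (cases "z \<in> cells n p q")
    case False
    then show ?thesis using PiE_arb[OF tabsD(1)[OF T]] by (simp add: extend_def)
  next
    case True
    obtain i j where z: "z = (i, j)" by fastforce
    show ?thesis using True entry_outside_profile(2)[OF T, of i j]
      unfolding z by (auto simp: extend_def)
  qed
qed

lemma profile_extend:
  assumes v: "v \<in> strips R C n p q (Suc N)" and T: "T \<in> tabs R C n p v N"
  shows "profile n p q N (extend n p q v (Suc N) T) = v"
proof
  fix i
  show "profile n p q N (extend n p q v (Suc N) T) i = v i"
  proof (cases "i < n")
    case False
    then show ?thesis using PiE_arb[OF stripsD(1)[OF v]] by (simp add: profile_def)
  next
    case True
    have b: "p i \<le> v i" "v i \<le> q i" using stripsD[OF v] True by auto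
    have iff: "extend n p q v (Suc N) T (i, j) \<le> N \<longleftrightarrow> j \<le> v i" if "j \<in> {p i<..q i}" for j
    proof -
      have "T (i, j) \<in> {1..N}" if "(i, j) \<in> cells n p v" by (rule PiE_mem[OF tabsD(1)[OF T] that])
      then show ?thesis using that True by (auto simp: extend_def)
    qed
    have "Max (insert (p i) {j \<in> {p i<..q i}. extend n p q v (Suc N) T (i, j) \<le> N}) = v i"
    proof (rule Max_eqI)
      show "v i \<in> insert (p i) {j \<in> {p i<..q i}. extend n p q v (Suc N) T (i, j) \<le> N}"
        using iff[of "v i"] b by auto
    qed (use iff b in auto)
    then show ?thesis using True by (simp add: profile_def)
  qed
qed

lemma restrict_extend:
  assumes v: "v \<in> strips R C n p q (Suc N)" and T: "T \<in> tabs R C n p v N"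
  shows "restrict (extend n p q v (Suc N) T) (cells n p v) = T"
proof
  fix z
  show "restrict (extend n p q v (Suc N) T) (cells n p v) z = T z"
  proof (cases "z \<in> cells n p v")
    case True
    then have "z \<in> cells n p q" using stripsD[OF v] by (cases z) force
    then show ?thesis using True by (simp add: extend_def)
  next
    case False
    then show ?thesis using PiE_arb[OF tabsD(1)[OF T], of z] by simp
  qed
qed

lemma tab_weight_extend:
  fixes x :: "nat \<Rightarrow> int \<Rightarrow> 'a :: comm_ring_1"
  assumes v: "v \<in> strips R C n p q (Suc N)"
  shows "(\<Prod>(i, j)\<in>cells n p q. x (extend n p q v (Suc N) T (i, j)) (j - int i))
    = (\<Prod>i<n. run_weight (x (Suc N)) (v i - int i) (q i - int i))
      * (\<Prod>(i, j)\<in>cells n p v. x (T (i, j)) (j - int i))"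
proof -
  let ?E = "extend n p q v (Suc N) T"
  have un: "cells n p q = cells n v q \<union> cells n p v" "cells n v q \<inter> cells n p v = {}"
    using stripsD[OF v] by force+
  have "(\<Prod>(i, j)\<in>cells n p q. x (?E (i, j)) (j - int i))
      = (\<Prod>(i, j)\<in>cells n v q. x (?E (i, j)) (j - int i))
        * (\<Prod>(i, j)\<in>cells n p v. x (?E (i, j)) (j - int i))"
    unfolding un(1) by (rule prod.union_disjoint) (auto simp: un(2))
  also have "(\<Prod>(i, j)\<in>cells n p v. x (?E (i, j)) (j - int i))
      = (\<Prod>(i, j)\<in>cells n p v. x (T (i, j)) (j - int i))"
    by (rule prod.cong) (use un in \<open>auto simp: extend_def\<close>)
  also have "(\<Prod>(i, j)\<in>cells n v q. x (?E (i, j)) (j - int i))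
      = (\<Prod>(i, j)\<in>cells n v q. x (Suc N) (j - int i))"
    by (rule prod.cong) (use un in \<open>auto simp: extend_def\<close>)
  also have "\<dots> = (\<Prod>i<n. \<Prod>j\<in>{v i<..q i}. x (Suc N) (j - int i))"
    unfolding cells_def by (rule prod.Sigma[symmetric]) auto
  also have "\<dots> = (\<Prod>i<n. run_weight (x (Suc N)) (v i - int i) (q i - int i))"
    unfolding run_weight_def
    by (rule prod.cong[OF refl], rule prod.reindex_bij_witness[of _ "\<lambda>k. k + int _" "\<lambda>j. j - int _"]) auto
  finally show ?thesis .
qed

text \<open>
  Tableaux with entries at most \<open>N + 1\<close> correspond to pairs of a strip and a tableau with
  entries at most \<open>N\<close> on the shape inside it: \<open>profile\<close> and restriction go one way,
  \<open>extend\<close> goes back.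
\<close>
lemma tab_sum_Suc:
  fixes x :: "nat \<Rightarrow> int \<Rightarrow> 'a :: comm_ring_1"
  shows "tab_sum R C x n p q (Suc N) =
    (\<Sum>v\<in>strips R C n p q (Suc N).
       (\<Prod>i<n. run_weight (x (Suc N)) (v i - int i) (q i - int i)) * tab_sum R C x n p v N)"
proof -
  let ?S = "Sigma (strips R C n p q (Suc N)) (\<lambda>v. tabs R C n p v N)"
  have "tab_sum R C x n p q (Suc N) = (\<Sum>(v, T)\<in>?S.
       (\<Prod>i<n. run_weight (x (Suc N)) (v i - int i) (q i - int i)) *
       (\<Prod>(i, j)\<in>cells n p v. x (T (i, j)) (j - int i)))"
    unfolding tab_sum_def
    by (rule sum.reindex_bij_witness[of _ "\<lambda>(v, T). extend n p q v (Suc N) T"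
          "\<lambda>T. (profile n p q N T, restrict T (cells n p (profile n p q N T)))"])
      (auto simp: extend_restrict profile_extend restrict_extend profile_in_strips
        restrict_in_tabs extend_in_tabs tab_weight_extend[OF profile_in_strips, symmetric]
        simp del: mem_cells)
  also have "\<dots> = (\<Sum>v\<in>strips R C n p q (Suc N).
       (\<Prod>i<n. run_weight (x (Suc N)) (v i - int i) (q i - int i)) * tab_sum R C x n p v N)"
    unfolding tab_sum_def sum_distrib_left by (rule sum.Sigma[symmetric]) auto
  finally show ?thesis .
qed

end

section \<open>Determinants and their expansion in the number of variables\<close>

text \<open>
  With rows numbered from \<open>0\<close>, the contents in row \<open>i\<close> end at \<open>q i - i\<close>, and those in row \<open>j\<close> start just
  after \<open>p j - j\<close>.
\<close>
definition jacobi_trudi :: "(int \<Rightarrow> int \<Rightarrow> 'a :: comm_ring_1) \<Rightarrow> nat \<Rightarrow> (nat \<Rightarrow> int) \<Rightarrow> (nat \<Rightarrow> int) \<Rightarrow> 'a" where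
  "jacobi_trudi H n p q = det (mat n n (\<lambda>(i, j). H (p j - int j) (q i - int i)))"

text \<open>
  The generating functions of weakly (\<open>complete_sum\<close>) and strictly (\<open>elementary_sum\<close>) increasing
  sequences with entries at most \<open>N\<close> on the contents \<open>a + 1, \<dots>, b\<close>, by recursion on the largest
  entry: \<open>v\<close> is the last content that it does not occupy. In a strict sequence this entry occurs at
  most once.
\<close>
fun complete_sum :: "(nat \<Rightarrow> int \<Rightarrow> 'a :: comm_ring_1) \<Rightarrow> nat \<Rightarrow> int \<Rightarrow> int \<Rightarrow> 'a" where
  "complete_sum x 0 a b = (if a = b then 1 else 0)"
| "complete_sum x (Suc N) a b = (\<Sum>v\<in>{a..b}. run_weight (x (Suc N)) v b * complete_sum x N a v)"

fun elementary_sum :: "(nat \<Rightarrow> int \<Rightarrow> 'a :: comm_ring_1) \<Rightarrow> nat \<Rightarrow> int \<Rightarrow> int \<Rightarrow> 'a" where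
  "elementary_sum x 0 a b = (if a = b then 1 else 0)"
| "elementary_sum x (Suc N) a b = (\<Sum>v\<in>{b - 1..b}. run_weight (x (Suc N)) v b * elementary_sum x N a v)"

lemma complete_sum_eq_0: "b < a \<Longrightarrow> complete_sum x N a b = 0"
  by (cases N) auto

text \<open>
  The Leibniz formula over \<open>{..<n}\<close>, the index set that the products over rows use.
\<close>
lemma det_mat_leibniz:
  "det (mat n n M) = (\<Sum>\<sigma> | \<sigma> permutes {..<n}. signof \<sigma> * (\<Prod>i<n. M (i, \<sigma> i)))"
proof -
  have "det (mat n n M) = (\<Sum>\<sigma> | \<sigma> permutes {0..<n}. signof \<sigma> * (\<Prod>i = 0..<n. mat n n M $$ (i, \<sigma> i)))"
    by (rule det_def') simp
  also have "\<dots> = (\<Sum>\<sigma> | \<sigma> permutes {0..<n}. signof \<sigma> * (\<Prod>i = 0..<n. M (i, \<sigma> i)))"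
  proof (rule sum.cong[OF refl], rule arg_cong2[of _ _ _ _ times], rule refl, rule prod.cong[OF refl])
    fix \<sigma> i assume "\<sigma> \<in> {\<sigma>. \<sigma> permutes {0..<n}}" "i \<in> {0..<n}"
    then have "i < n" "\<sigma> i < n" using permutes_in_image[of \<sigma> "{0..<n}" i] by auto
    then show "mat n n M $$ (i, \<sigma> i) = M (i, \<sigma> i)" by simp
  qed
  finally show ?thesis by (simp add: atLeast0LessThan)
qed

text \<open>
  Multilinearity in all rows at once. The coefficients \<open>w i v\<close> must not depend on the column \<open>j\<close>.
\<close>
lemma det_row_sums:
  fixes w :: "nat \<Rightarrow> 'b \<Rightarrow> 'a :: comm_ring_1"
  assumes "\<And>i. i < n \<Longrightarrow> finite (V i)"
  shows "det (mat n n (\<lambda>(i, j). \<Sum>v\<in>V i. w i v * g i v j))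
    = (\<Sum>f\<in>Pi\<^sub>E {..<n} V. (\<Prod>i<n. w i (f i)) * det (mat n n (\<lambda>(i, j). g i (f i) j)))"
proof -
  have "(\<Prod>i<n. \<Sum>v\<in>V i. w i v * g i v (\<sigma> i))
      = (\<Sum>f\<in>Pi\<^sub>E {..<n} V. (\<Prod>i<n. w i (f i)) * (\<Prod>i<n. g i (f i) (\<sigma> i)))" for \<sigma>
    by (subst prod_sum_PiE) (use assms in \<open>auto simp: prod.distrib\<close>)
  then show ?thesis
    unfolding det_mat_leibniz
    by (simp add: sum_distrib_left mult.left_commute) (rule sum.swap)
qed

text \<open>
  The row operations are left multiplication by a unipotent upper triangular matrix, so all of them
  can be performed simultaneously with the original rows on the right hand side.
\<close>
lemma det_subtract_next_row:
  fixes g :: "nat \<Rightarrow> nat \<Rightarrow> 'a :: comm_ring_1"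
  shows "det (mat n n (\<lambda>(i, j). if Suc i < n then g i j - r i * g (Suc i) j else g i j))
    = det (mat n n (\<lambda>(i, j). g i j))"
proof -
  define U where "U = mat n n (\<lambda>(i, k). if k = i then 1 else if k = Suc i then - r i else 0)"
  let ?M = "mat n n (\<lambda>(i, j). g i j)"
  have U: "U \<in> carrier_mat n n" and M: "?M \<in> carrier_mat n n" by (simp_all add: U_def)
  have "mat n n (\<lambda>(i, j). if Suc i < n then g i j - r i * g (Suc i) j else g i j) = U * ?M"
  proof (rule eq_matI)
    fix i j assume "i < dim_row (U * ?M)" "j < dim_col (U * ?M)"
    then have ij: "i < n" "j < n" by (simp_all add: U_def)
    have "(U * ?M) $$ (i, j)
        = (\<Sum>k<n. (if k = i then 1 else if k = Suc i then - r i else 0) * g k j)"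
      using ij by (simp add: U_def scalar_prod_def atLeast0LessThan)
    also have "\<dots> = (\<Sum>k<n. (if k = i then g k j else 0) + (if k = Suc i then - (r i * g k j) else 0))"
      by (rule sum.cong) auto
    also have "\<dots> = (if Suc i < n then g i j - r i * g (Suc i) j else g i j)"
      using ij by (simp add: sum.distrib)
    finally show "mat n n (\<lambda>(i, j). if Suc i < n then g i j - r i * g (Suc i) j else g i j) $$ (i, j)
        = (U * ?M) $$ (i, j)"
      using ij by simp
  qed (simp_all add: U_def)
  moreover have "det U = 1"
  proof -
    have "upper_triangular U" unfolding upper_triangular_def by (auto simp: U_def)
    then have "det U = prod_list (diag_mat U)" by (rule det_upper_triangular[OF _ U])
    also have "diag_mat U = map (\<lambda>_. 1) [0..<n]" unfolding diag_mat_def by (auto simp: U_def)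
    also have "prod_list (map (\<lambda>_. 1) xs) = (1 :: 'a)" for xs :: "nat list" by (induction xs) auto
    finally show ?thesis .
  qed
  ultimately show ?thesis by (simp add: det_mult[OF U M])
qed

text \<open>
  In row \<open>i\<close> the terms with \<open>v\<close> at most the end of row \<open>i + 1\<close> add up to a multiple of row \<open>i + 1\<close>,
  because a run from \<open>v\<close> to the end of row \<open>i\<close> passes through the end of row \<open>i + 1\<close>. The last row has no
  successor, but there the bound \<open>p i\<close> loses nothing: since \<open>p\<close> is decreasing, no
  sequence that ends before content \<open>p i - i\<close> has room to start at any \<open>p j - j\<close>.
\<close>
lemma jacobi_trudi_complete_sum_Suc:
  fixes x :: "nat \<Rightarrow> int \<Rightarrow> 'a :: comm_ring_1"
  assumes p: "decreasing n p" and q: "decreasing n q"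
  shows "jacobi_trudi (complete_sum x (Suc N)) n p q =
    (\<Sum>v\<in>(\<Pi>\<^sub>E i\<in>{..<n}. {(if Suc i < n then q (Suc i) else p i)..q i}).
       (\<Prod>i<n. run_weight (x (Suc N)) (v i - int i) (q i - int i)) * jacobi_trudi (complete_sum x N) n p v)"
proof -
  let ?V = "\<lambda>i. {(if Suc i < n then q (Suc i) else p i)..q i}"
  let ?X = "run_weight (x (Suc N))"
  let ?g = "\<lambda>i j. complete_sum x (Suc N) (p j - int j) (q i - int i)"
  let ?r = "\<lambda>i. ?X (q (Suc i) - int (Suc i)) (q i - int i)"
  have row: "(if Suc i < n then ?g i j - ?r i * ?g (Suc i) j else ?g i j)
      = (\<Sum>v\<in>?V i. ?X (v - int i) (q i - int i) * complete_sum x N (p j - int j) (v - int i))"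
    if ij: "i < n" "j < n" for i j
  proof -
    let ?a = "p j - int j" and ?b = "q i - int i"
    have shift: "(\<Sum>v\<in>?V i. ?X (v - int i) ?b * complete_sum x N ?a (v - int i))
        = (\<Sum>u\<in>{(if Suc i < n then q (Suc i) else p i) - int i..?b}. ?X u ?b * complete_sum x N ?a u)"
      by (rule sum.reindex_bij_witness[of _ "\<lambda>u. u + int i" "\<lambda>v. v - int i"]) auto
    show ?thesis
    proof (cases "Suc i < n")
      case True
      let ?b' = "q (Suc i) - int (Suc i)"
      have bb: "?b' < ?b" using decreasingD[OF q, of i "Suc i"] True by simp
      \<comment> \<open>The part of row i that the row operation removes.\<close>
      have "?r i * ?g (Suc i) j = (\<Sum>u\<in>{?a..?b'}. ?X u ?b * complete_sum x N ?a u)"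
        unfolding complete_sum.simps sum_distrib_left
      proof (rule sum.cong[OF refl])
        fix u assume "u \<in> {?a..?b'}"
        then have "?X u ?b = ?X u ?b' * ?r i" using bb by (intro run_weight_mult) auto
        then show "?r i * (?X u ?b' * complete_sum x N ?a u) = ?X u ?b * complete_sum x N ?a u"
          by (simp only: mult_ac)
      qed
      moreover have "?g i j = (\<Sum>u\<in>{?a..?b'} \<union> {?b'<..?b}. ?X u ?b * complete_sum x N ?a u)"
        unfolding complete_sum.simps
        by (rule sum.mono_neutral_left) (use bb in \<open>auto simp: complete_sum_eq_0\<close>)
      moreover have "(\<Sum>u\<in>{?a..?b'} \<union> {?b'<..?b}. ?X u ?b * complete_sum x N ?a u)
          = (\<Sum>u\<in>{?a..?b'}. ?X u ?b * complete_sum x N ?a u) + (\<Sum>u\<in>{?b'<..?b}. ?X u ?b * complete_sum x N ?a u)"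
        by (rule sum.union_disjoint) auto
      moreover have "{q (Suc i) - int i..?b} = {?b'<..?b}" by auto
      ultimately show ?thesis unfolding shift unfolding if_P[OF True] by (simp only: add_diff_cancel_left')
    next
      case False
      then have "p i - int i \<le> ?a" using decreasingD[OF p, of j i] ij by simp
      then have "?g i j = (\<Sum>u\<in>{p i - int i..?b}. ?X u ?b * complete_sum x N ?a u)"
        unfolding complete_sum.simps by (intro sum.mono_neutral_left) (auto simp: complete_sum_eq_0)
      then show ?thesis unfolding shift using False by simp
    qed
  qed
  have "jacobi_trudi (complete_sum x (Suc N)) n p q
      = det (mat n n (\<lambda>(i, j). if Suc i < n then ?g i j - ?r i * ?g (Suc i) j else ?g i j))"
    unfolding jacobi_trudi_def by (rule det_subtract_next_row[symmetric])
  also have "\<dots> = det (mat n n (\<lambda>(i, j).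
      \<Sum>v\<in>?V i. ?X (v - int i) (q i - int i) * complete_sum x N (p j - int j) (v - int i)))"
    by (rule arg_cong[of _ _ det], rule cong_mat[OF refl refl]) (simp only: row prod.case)
  also have "\<dots> = (\<Sum>v\<in>Pi\<^sub>E {..<n} ?V. (\<Prod>i<n. ?X (v i - int i) (q i - int i)) * jacobi_trudi (complete_sum x N) n p v)"
    unfolding jacobi_trudi_def by (rule det_row_sums) simp
  finally show ?thesis .
qed

lemma jacobi_trudi_elementary_sum_Suc:
  fixes x :: "nat \<Rightarrow> int \<Rightarrow> 'a :: comm_ring_1"
  shows "jacobi_trudi (elementary_sum x (Suc N)) n p q = (\<Sum>v\<in>(\<Pi>\<^sub>E i\<in>{..<n}. {q i - 1..q i}).
       (\<Prod>i<n. run_weight (x (Suc N)) (v i - int i) (q i - int i)) * jacobi_trudi (elementary_sum x N) n p v)"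
proof -
  let ?X = "run_weight (x (Suc N))"
  have row: "elementary_sum x (Suc N) a (q i - int i)
      = (\<Sum>v\<in>{q i - 1..q i}. ?X (v - int i) (q i - int i) * elementary_sum x N a (v - int i))" for a i
    unfolding elementary_sum.simps
    by (rule sum.reindex_bij_witness[of _ "\<lambda>v. v - int i" "\<lambda>u. u + int i"]) auto
  show ?thesis
    unfolding jacobi_trudi_def row by (rule det_row_sums) simp
qed

text \<open>
  If lowering some ends by one destroys monotonicity, then two adjacent rows had the same length and
  only the upper one was shortened. Their ends then have equal contents, so the matrix has equal rows.
\<close>
lemma jacobi_trudi_not_decreasing:
  assumes q: "decreasing n q" and v: "v \<in> (\<Pi>\<^sub>E i\<in>{..<n}. {q i - 1..q i})" and "\<not> decreasing n v"
  shows "jacobi_trudi H n p v = 0"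
proof -
  obtain i where i: "Suc i < n" "v i < v (Suc i)"
    using \<open>\<not> decreasing n v\<close> decreasing_SucI[of n v] by force
  have "v i \<in> {q i - 1..q i}" "v (Suc i) \<in> {q (Suc i) - 1..q (Suc i)}"
    using PiE_mem[OF v] i by auto
  then have "v (Suc i) - int (Suc i) = v i - int i"
    using decreasingD[OF q, of i "Suc i"] i by simp
  then show ?thesis unfolding jacobi_trudi_def
    by (intro det_identical_rows[of _ n i "Suc i"]) (use i in \<open>auto simp del: of_nat_Suc\<close>)
qed

text \<open>
  Subtracting the row number turns weakly decreasing shapes into strictly decreasing sequences, and two
  of these with the same values agree position by position.
\<close>
lemma decreasing_perm_eq:
  assumes p: "decreasing n p" and q: "decreasing n q" and \<sigma>: "\<sigma> permutes {..<n}"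
    and eq: "\<And>i. i < n \<Longrightarrow> p (\<sigma> i) - int (\<sigma> i) = q i - int i"
  shows "\<sigma> = id"
proof (rule permutes_natset_ge[OF \<sigma>], rule ballI)
  fix i assume "i \<in> {..<n}"
  then have "i < n" by simp
  then show "i \<le> \<sigma> i"
  proof (induction i)
    case (Suc i)
    have mem: "\<sigma> i < n" "\<sigma> (Suc i) < n"
      using permutes_in_image[OF \<sigma>] Suc by auto
    have "\<sigma> i < \<sigma> (Suc i)"
    proof (rule ccontr)
      assume "\<not> \<sigma> i < \<sigma> (Suc i)"
      then have "p (\<sigma> i) - int (\<sigma> i) \<le> p (\<sigma> (Suc i)) - int (\<sigma> (Suc i))"
        using decreasingD[OF p, of "\<sigma> (Suc i)" "\<sigma> i"] mem by simp
      then show False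
        using eq[of i] eq[of "Suc i"] decreasingD[OF q, of i "Suc i"] Suc.prems by simp
    qed
    then show ?case using Suc by simp
  qed simp
qed

text \<open>
  The case without variables: only the identity permutation can contribute.
\<close>
lemma jacobi_trudi_delta:
  assumes p: "decreasing n p" and q: "decreasing n q"
  shows "jacobi_trudi (\<lambda>a b. if a = b then 1 else 0) n p q = (if \<forall>i<n. p i = q i then 1 else 0)"
proof -
  have "(\<Prod>i<n. if p (\<sigma> i) - int (\<sigma> i) = q i - int i then 1 else 0 :: 'a)
      = (if \<sigma> = id \<and> (\<forall>i<n. p i = q i) then 1 else 0)" if "\<sigma> permutes {..<n}" for \<sigma>
  proof (cases "\<forall>i<n. p (\<sigma> i) - int (\<sigma> i) = q i - int i")
    case True
    then have "\<sigma> = id" using decreasing_perm_eq[OF p q that] by blast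
    then show ?thesis using True by simp
  next
    case False
    then have "(\<Prod>i<n. if p (\<sigma> i) - int (\<sigma> i) = q i - int i then 1 else 0 :: 'a) = 0"
      by (intro prod_zero) auto
    then show ?thesis using False by auto
  qed
  then have "jacobi_trudi (\<lambda>a b. if a = b then 1 else 0 :: 'a) n p q
      = (\<Sum>\<sigma> | \<sigma> permutes {..<n}. if \<sigma> = id \<and> (\<forall>i<n. p i = q i) then signof \<sigma> else 0)"
    unfolding jacobi_trudi_def det_mat_leibniz by (intro sum.cong) auto
  also have "\<dots> = (if \<forall>i<n. p i = q i then signof (id :: nat \<Rightarrow> nat) else 0)"
    by (cases "\<forall>i<n. p i = q i") (auto simp: sum.delta finite_permutations permutes_id intro!: sum.neutral)
  finally show ?thesis by simp
qed

lemma tab_sum_0: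
  assumes "\<And>i. i < n \<Longrightarrow> p i \<le> q i"
  shows "tab_sum R C x n p q 0 = (if \<forall>i<n. p i = q i then 1 else 0)"
proof (cases "\<forall>i<n. p i = q i")
  case True
  then have "cells n p q = {}" by auto
  then show ?thesis using True by (simp add: tab_sum_def tabs_def)
next
  case False
  then obtain i where "i < n" "p i < q i" using assms by (metis order_le_less)
  then have "(i, q i) \<in> cells n p q" by simp
  then have "tabs R C n p q 0 = {}" by (auto simp: tabs_def PiE_iff simp del: mem_cells)
  then show ?thesis using False by (simp add: tab_sum_def)
qed

section \<open>Equality of determinants and tableau sums\<close>

text \<open>
  Two neighbouring cells of the same row cannot carry equal entries, so a row loses at most its last cell.
\<close>
lemma strips_row_strict:
  assumes q: "decreasing n q"
  shows "strips (<) (\<le>) n p q M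
    = {v \<in> (\<Pi>\<^sub>E i\<in>{..<n}. {q i - 1..q i}). decreasing n v \<and> (\<forall>i<n. p i \<le> v i)}"
proof (intro equalityI subsetI)
  fix v assume v: "v \<in> strips (<) (\<le>) n p q M"
  have "q i - 1 \<le> v i" if "i < n" for i
  proof (rule ccontr)
    assume "\<not> q i - 1 \<le> v i"
    then have "(i, q i - 1) \<in> cells n v q" "(i, q i) \<in> cells n v q" using that by auto
    moreover have "q i - 1 < q i" by simp
    ultimately have "M < M" using v unfolding strips_def by blast
    then show False by simp
  qed
  then show "v \<in> {v \<in> (\<Pi>\<^sub>E i\<in>{..<n}. {q i - 1..q i}). decreasing n v \<and> (\<forall>i<n. p i \<le> v i)}"
    using stripsD[OF v] by (auto simp: PiE_iff)
next
  fix v assume v: "v \<in> {v \<in> (\<Pi>\<^sub>E i\<in>{..<n}. {q i - 1..q i}). decreasing n v \<and> (\<forall>i<n. p i \<le> v i)}"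
  then have "q i - 1 \<le> v i" if "i < n" for i using that by (auto simp: PiE_iff)
  then have "\<not> j < l" if "(i, j) \<in> cells n v q" "(i, l) \<in> cells n v q" for i j l
    using that by force
  then show "v \<in> strips (<) (\<le>) n p q M"
    using v unfolding strips_def by (auto simp: PiE_iff simp del: mem_cells)
qed

text \<open>
  If row \<open>i\<close> were cut below the length of row \<open>i + 1\<close>, then the last cell of row \<open>i + 1\<close> and the cell
  above it would carry equal entries. Conversely the interlacing \<open>q (i + 1) \<le> v i\<close> separates the columns
  of erased cells in different rows.
\<close>
lemma strips_col_strict:
  assumes q: "decreasing n q"
  shows "strips (\<le>) (<) n p q M
    = {v \<in> (\<Pi>\<^sub>E i\<in>{..<n}. {(if Suc i < n then q (Suc i) else p i)..q i}). decreasing n v \<and> (\<forall>i<n. p i \<le> v i)}"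
    (is "_ = ?S")
proof (intro equalityI subsetI)
  fix v assume v: "v \<in> strips (\<le>) (<) n p q M"
  have "q (Suc i) \<le> v i" if i: "Suc i < n" for i
  proof (rule ccontr)
    assume "\<not> q (Suc i) \<le> v i"
    moreover have "v (Suc i) \<le> v i" "q (Suc i) \<le> q i"
      using decreasingD[OF stripsD(2)[OF v], of i "Suc i"] decreasingD[OF q, of i "Suc i"] i by auto
    ultimately have "(i, q (Suc i)) \<in> cells n v q" "(Suc i, q (Suc i)) \<in> cells n v q" using i by auto
    then have "M < M" using v unfolding strips_def by (auto simp del: mem_cells)
    then show False by simp
  qed
  then show "v \<in> ?S"
    using stripsD[OF v] by (auto simp: PiE_iff)
next
  fix v assume v: "v \<in> ?S"
  have vi: "v i \<in> {(if Suc i < n then q (Suc i) else p i)..q i}" if "i < n" for i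
    by (rule PiE_mem[of v "{..<n}"]) (use v that in blast)+
  then have le: "q (Suc i) \<le> v i" if "Suc i < n" for i
    using vi[of i] that by simp
  have col: "\<not> i < k" if "(i, j) \<in> cells n v q" "(k, j) \<in> cells n v q" for i j k
  proof
    assume "i < k"
    then have "q k \<le> v i" using le[of i] decreasingD[OF q, of "Suc i" k] that by auto
    then show False using that by simp
  qed
  show "v \<in> strips (\<le>) (<) n p q M"
  proof -
    have "v \<in> (\<Pi>\<^sub>E i\<in>{..<n}. {p i..q i})" using v vi by (simp add: PiE_iff)
    then show ?thesis using v col unfolding strips_def by blast
  qed
qed

text \<open>
  The induction step shared by both monotonicity types. The statement includes shapes \<open>q\<close> that do not
  contain \<open>p\<close>, with value \<open>0\<close>: the expansion of the determinant also produces such shapes, and carrying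
  them through the induction replaces a separate argument that their determinants vanish.
\<close>
lemma jacobi_trudi_eq_tab_sum_step:
  fixes x :: "nat \<Rightarrow> int \<Rightarrow> 'a :: comm_ring_1"
  assumes R: "\<And>a b. a < b \<Longrightarrow> R a b" "\<And>a b. R a b \<Longrightarrow> a \<le> b"
    and C: "\<And>a b. a < b \<Longrightarrow> C a b" "\<And>a b. C a b \<Longrightarrow> a \<le> b"
    and p: "decreasing n p" and q: "decreasing n q"
    and fin: "\<And>i. finite (V i)" and V: "\<And>i v. i < n \<Longrightarrow> v \<in> V i \<Longrightarrow> v \<le> q i"
    and expand: "jacobi_trudi H' n p q = (\<Sum>v\<in>Pi\<^sub>E {..<n} V.
       (\<Prod>i<n. run_weight (x (Suc N)) (v i - int i) (q i - int i)) * jacobi_trudi H n p v)"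
    and vanish: "\<And>v. v \<in> Pi\<^sub>E {..<n} V \<Longrightarrow> \<not> decreasing n v \<Longrightarrow> jacobi_trudi H n p v = 0"
    and IH: "\<And>v. decreasing n v \<Longrightarrow>
       jacobi_trudi H n p v = (if \<forall>i<n. p i \<le> v i then tab_sum R C x n p v N else 0)"
    and strips: "strips R C n p q (Suc N) = {v \<in> Pi\<^sub>E {..<n} V. decreasing n v \<and> (\<forall>i<n. p i \<le> v i)}"
  shows "jacobi_trudi H' n p q = (if \<forall>i<n. p i \<le> q i then tab_sum R C x n p q (Suc N) else 0)"
proof -
  have "jacobi_trudi H' n p q = (\<Sum>v\<in>strips R C n p q (Suc N).
      (\<Prod>i<n. run_weight (x (Suc N)) (v i - int i) (q i - int i)) * jacobi_trudi H n p v)"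
    unfolding expand strips
  proof (rule sum.mono_neutral_right)
    show "\<forall>v\<in>Pi\<^sub>E {..<n} V - {v \<in> Pi\<^sub>E {..<n} V. decreasing n v \<and> (\<forall>i<n. p i \<le> v i)}.
        (\<Prod>i<n. run_weight (x (Suc N)) (v i - int i) (q i - int i)) * jacobi_trudi H n p v = 0"
    proof
      fix v assume "v \<in> Pi\<^sub>E {..<n} V - {v \<in> Pi\<^sub>E {..<n} V. decreasing n v \<and> (\<forall>i<n. p i \<le> v i)}"
      then have v: "v \<in> Pi\<^sub>E {..<n} V" "\<not> (decreasing n v \<and> (\<forall>i<n. p i \<le> v i))" by blast+
      have "jacobi_trudi H n p v = 0"
      proof (cases "decreasing n v")
        case True
        then have "\<not> (\<forall>i<n. p i \<le> v i)" using v(2) by blast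
        then show ?thesis unfolding IH[OF True] by (rule if_not_P)
      qed (rule vanish[OF v(1)])
      then show "(\<Prod>i<n. run_weight (x (Suc N)) (v i - int i) (q i - int i)) * jacobi_trudi H n p v = 0" by simp
    qed
  qed (auto intro: finite_PiE fin)
  also have "\<dots> = (\<Sum>v\<in>strips R C n p q (Suc N).
      (\<Prod>i<n. run_weight (x (Suc N)) (v i - int i) (q i - int i)) * tab_sum R C x n p v N)"
  proof (rule sum.cong[OF refl])
    fix v assume "v \<in> strips R C n p q (Suc N)"
    then have "jacobi_trudi H n p v = tab_sum R C x n p v N" using IH[of v] unfolding strips by simp
    then show "(\<Prod>i<n. run_weight (x (Suc N)) (v i - int i) (q i - int i)) * jacobi_trudi H n p v
      = (\<Prod>i<n. run_weight (x (Suc N)) (v i - int i) (q i - int i)) * tab_sum R C x n p v N" by simp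
  qed
  finally have main: "jacobi_trudi H' n p q = \<dots>" .
  show ?thesis
  proof (cases "\<forall>i<n. p i \<le> q i")
    case True
    then show ?thesis unfolding main by (simp add: tab_sum_Suc[OF R C p q])
  next
    case False
    then obtain i where i: "i < n" "\<not> p i \<le> q i" by blast
    have "\<not> p i \<le> v i" if "v \<in> Pi\<^sub>E {..<n} V" for v
      using V[OF i(1) PiE_mem[OF that]] i by simp
    then have "strips R C n p q (Suc N) = {}" using i(1) unfolding strips by blast
    then have "jacobi_trudi H' n p q = 0" unfolding main by simp
    then show ?thesis unfolding if_not_P[OF False] .
  qed
qed

lemma jacobi_trudi_complete_sum:
  fixes x :: "nat \<Rightarrow> int \<Rightarrow> 'a :: comm_ring_1"
  assumes "decreasing n p" "decreasing n q"
  shows "jacobi_trudi (complete_sum x N) n p q = (if \<forall>i<n. p i \<le> q i then tab_sum (\<le>) (<) x n p q N else 0)"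
  using assms(2)
proof (induction N arbitrary: q)
  case 0
  have "complete_sum x 0 = (\<lambda>a b. if a = b then 1 else 0)" by (intro ext) simp
  then have jacobi_trudi: "jacobi_trudi (complete_sum x 0) n p q = (if \<forall>i<n. p i = q i then 1 else 0)"
    by (simp only: jacobi_trudi_delta[OF assms(1) 0])
  show ?case
  proof (cases "\<forall>i<n. p i \<le> q i")
    case True
    then show ?thesis unfolding jacobi_trudi using tab_sum_0[of n p q "(\<le>)" "(<)" x] by simp
  next
    case False
    then have "\<not> (\<forall>i<n. p i = q i)" by auto
    then show ?thesis using False unfolding jacobi_trudi by (simp only: if_False)
  qed
next
  case (Suc N)
  let ?V = "\<lambda>i. {(if Suc i < n then q (Suc i) else p i)..q i}"
  show ?case
  proof (rule jacobi_trudi_eq_tab_sum_step[OF _ _ _ _ assms(1) Suc.prems, where V = ?V and H = "complete_sum x N"])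
    fix v assume v: "v \<in> Pi\<^sub>E {..<n} ?V" "\<not> decreasing n v"
    have "v (Suc i) \<le> v i" if "Suc i < n" for i
      using PiE_mem[OF v(1), of i] PiE_mem[OF v(1), of "Suc i"] that by simp
    then show "jacobi_trudi (complete_sum x N) n p v = 0" using v(2) decreasing_SucI by blast
  next
    show "jacobi_trudi (complete_sum x (Suc N)) n p q = (\<Sum>v\<in>Pi\<^sub>E {..<n} ?V.
        (\<Prod>i<n. run_weight (x (Suc N)) (v i - int i) (q i - int i)) * jacobi_trudi (complete_sum x N) n p v)"
      by (rule jacobi_trudi_complete_sum_Suc[OF assms(1) Suc.prems])
  next
    show "strips (\<le>) (<) n p q (Suc N)
        = {v \<in> Pi\<^sub>E {..<n} ?V. decreasing n v \<and> (\<forall>i<n. p i \<le> v i)}"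
      by (rule strips_col_strict[OF Suc.prems])
  next
    show "decreasing n v \<Longrightarrow> jacobi_trudi (complete_sum x N) n p v
        = (if \<forall>i<n. p i \<le> v i then tab_sum (\<le>) (<) x n p v N else 0)" for v
      by (rule Suc.IH)
  qed auto
qed

lemma jacobi_trudi_elementary_sum:
  fixes x :: "nat \<Rightarrow> int \<Rightarrow> 'a :: comm_ring_1"
  assumes "decreasing n p" "decreasing n q"
  shows "jacobi_trudi (elementary_sum x N) n p q = (if \<forall>i<n. p i \<le> q i then tab_sum (<) (\<le>) x n p q N else 0)"
  using assms(2)
proof (induction N arbitrary: q)
  case 0
  have "elementary_sum x 0 = (\<lambda>a b. if a = b then 1 else 0)" by (intro ext) simp
  then have jacobi_trudi: "jacobi_trudi (elementary_sum x 0) n p q = (if \<forall>i<n. p i = q i then 1 else 0)"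
    by (simp only: jacobi_trudi_delta[OF assms(1) 0])
  show ?case
  proof (cases "\<forall>i<n. p i \<le> q i")
    case True
    then show ?thesis unfolding jacobi_trudi using tab_sum_0[of n p q "(<)" "(\<le>)" x] by simp
  next
    case False
    then have "\<not> (\<forall>i<n. p i = q i)" by auto
    then show ?thesis using False unfolding jacobi_trudi by (simp only: if_False)
  qed
next
  case (Suc N)
  show ?case
  proof (rule jacobi_trudi_eq_tab_sum_step[OF _ _ _ _ assms(1) Suc.prems,
        where V = "\<lambda>i. {q i - 1..q i}" and H = "elementary_sum x N"])
    show "jacobi_trudi (elementary_sum x N) n p v = 0"
      if "v \<in> (\<Pi>\<^sub>E i\<in>{..<n}. {q i - 1..q i})" "\<not> decreasing n v" for v
      by (rule jacobi_trudi_not_decreasing[OF Suc.prems that])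
  next
    show "jacobi_trudi (elementary_sum x (Suc N)) n p q = (\<Sum>v\<in>(\<Pi>\<^sub>E i\<in>{..<n}. {q i - 1..q i}).
        (\<Prod>i<n. run_weight (x (Suc N)) (v i - int i) (q i - int i)) * jacobi_trudi (elementary_sum x N) n p v)"
      by (rule jacobi_trudi_elementary_sum_Suc)
  next
    show "strips (<) (\<le>) n p q (Suc N)
        = {v \<in> (\<Pi>\<^sub>E i\<in>{..<n}. {q i - 1..q i}). decreasing n v \<and> (\<forall>i<n. p i \<le> v i)}"
      by (rule strips_row_strict[OF Suc.prems])
  next
    show "decreasing n v \<Longrightarrow> jacobi_trudi (elementary_sum x N) n p v
        = (if \<forall>i<n. p i \<le> v i then tab_sum (<) (\<le>) x n p v N else 0)" for v
      by (rule Suc.IH)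
  qed auto
qed

lemma jacobi_trudi_1: "jacobi_trudi H 1 (\<lambda>_. a) (\<lambda>_. b) = H a b"
  unfolding jacobi_trudi_def by (subst det_single) simp_all

text \<open>
  A matrix of size one equals its entry, so the closed formula for the recursively defined row sums is
  the case of a single row.
\<close>
lemma complete_sum_eq_tab_sum:
  "complete_sum x N a b = (if a \<le> b then tab_sum (\<le>) (<) x 1 (\<lambda>_. a) (\<lambda>_. b) N else 0)"
proof -
  have "decreasing 1 (\<lambda>_. c)" for c by (simp add: decreasing_def)
  then have "complete_sum x N a b = (if \<forall>i<1::nat. a \<le> b then tab_sum (\<le>) (<) x 1 (\<lambda>_. a) (\<lambda>_. b) N else 0)"
    by (subst jacobi_trudi_1[of "complete_sum x N" a b, symmetric]) (rule jacobi_trudi_complete_sum)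
  then show ?thesis by (simp only: less_one simp_thms)
qed

lemma elementary_sum_eq_tab_sum:
  "elementary_sum x N a b = (if a \<le> b then tab_sum (<) (\<le>) x 1 (\<lambda>_. a) (\<lambda>_. b) N else 0)"
proof -
  have "decreasing 1 (\<lambda>_. c)" for c by (simp add: decreasing_def)
  then have "elementary_sum x N a b = (if \<forall>i<1::nat. a \<le> b then tab_sum (<) (\<le>) x 1 (\<lambda>_. a) (\<lambda>_. b) N else 0)"
    by (subst jacobi_trudi_1[of "elementary_sum x N" a b, symmetric]) (rule jacobi_trudi_elementary_sum)
  then show ?thesis by (simp only: less_one simp_thms)
qed

section \<open>Truncation to finitely many variables\<close>

definition bmonom :: "(nat \<Rightarrow>\<^sub>0 nat) \<Rightarrow> bseries" where
  "bmonom \<alpha> = Abs_bseries (\<lambda>\<beta>. if \<beta> = \<alpha> then 1 else 0)"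

lemma coeff_of_bmonom: "coeff_of (bmonom \<alpha>) \<beta> = (if \<beta> = \<alpha> then 1 else 0)"
proof -
  have "bounded_degree (\<lambda>\<beta>. if \<beta> = \<alpha> then 1 else 0)"
    by (rule bounded_degreeI[of _ "mdeg \<alpha>"]) (auto split: if_splits)
  then show ?thesis by (simp add: bmonom_def Abs_bseries_inverse)
qed

lemma bmonom_add: "bmonom (\<alpha> + \<beta>) = bmonom \<alpha> * bmonom \<beta>"
proof (rule bseries_eqI)
  fix \<theta>
  have "coeff_of (bmonom \<alpha> * bmonom \<beta>) \<theta>
      = (\<Sum>z\<in>splits \<theta>. if z = (\<alpha>, \<beta>) then 1 else 0)"
    unfolding times_bseries.rep_eq
    by (rule sum.cong) (auto simp: coeff_of_bmonom split: if_splits)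
  also have "\<dots> = (if (\<alpha>, \<beta>) \<in> splits \<theta> then 1 else 0)"
    by simp
  finally show "coeff_of (bmonom (\<alpha> + \<beta>)) \<theta> = coeff_of (bmonom \<alpha> * bmonom \<beta>) \<theta>"
    by (auto simp: coeff_of_bmonom splits_def)
qed

lemma bmonom_sum: "finite I \<Longrightarrow> bmonom (\<Sum>i\<in>I. e i) = (\<Prod>i\<in>I. bmonom (e i))"
proof (induction I rule: finite_induct)
  case empty
  show ?case by (rule bseries_eqI) (simp add: coeff_of_bmonom one_bseries.rep_eq)
qed (simp add: bmonom_add)

lemma coeff_of_sum: "coeff_of (\<Sum>i\<in>I. f i) \<alpha> = (\<Sum>i\<in>I. coeff_of (f i) \<alpha>)"
  by (induction I rule: infinite_finite_induct) (simp_all add: zero_bseries.rep_eq plus_bseries.rep_eq)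

lift_definition trunc :: "nat \<Rightarrow> bseries \<Rightarrow> bseries" is
  "\<lambda>N f \<alpha>. if Poly_Mapping.keys \<alpha> \<subseteq> {..N} then f \<alpha> else 0"
  unfolding bounded_degree_def by metis

lemma keys_add_nat:
  "Poly_Mapping.keys (\<alpha> + \<beta> :: nat \<Rightarrow>\<^sub>0 nat) = Poly_Mapping.keys \<alpha> \<union> Poly_Mapping.keys \<beta>"
  by (auto simp: in_keys_iff lookup_add)

interpretation trunc: comm_ring_hom "trunc N"
proof
  fix f g :: bseries
  show "trunc N (f + g) = trunc N f + trunc N g" "trunc N 0 = 0" "trunc N 1 = 1"
    by (rule bseries_eqI, simp add: trunc.rep_eq plus_bseries.rep_eq zero_bseries.rep_eq
        one_bseries.rep_eq)+
  show "trunc N (f * g) = trunc N f * trunc N g"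
  proof (rule bseries_eqI)
    fix \<theta>
    have "(if Poly_Mapping.keys \<theta> \<subseteq> {..N} then coeff_of f \<alpha> * coeff_of g \<beta> else 0)
        = coeff_of (trunc N f) \<alpha> * coeff_of (trunc N g) \<beta>" if "\<theta> = \<alpha> + \<beta>" for \<alpha> \<beta>
      unfolding that keys_add_nat by (auto simp: trunc.rep_eq)
    then have "(\<Sum>(\<alpha>, \<beta>)\<in>splits \<theta>. if Poly_Mapping.keys \<theta> \<subseteq> {..N} then coeff_of f \<alpha> * coeff_of g \<beta> else 0)
        = (\<Sum>(\<alpha>, \<beta>)\<in>splits \<theta>. coeff_of (trunc N f) \<alpha> * coeff_of (trunc N g) \<beta>)"
      by (intro sum.cong) (auto simp: splits_def)
    moreover have "coeff_of (trunc N (f * g)) \<theta>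
        = (\<Sum>(\<alpha>, \<beta>)\<in>splits \<theta>. if Poly_Mapping.keys \<theta> \<subseteq> {..N} then coeff_of f \<alpha> * coeff_of g \<beta> else 0)"
      by (cases "Poly_Mapping.keys \<theta> \<subseteq> {..N}") (simp_all add: trunc.rep_eq times_bseries.rep_eq)
    ultimately show "coeff_of (trunc N (f * g)) \<theta> = coeff_of (trunc N f * trunc N g) \<theta>"
      by (simp only: times_bseries.rep_eq)
  qed
qed

text \<open>
  Each monomial involves finitely many variables, so every coefficient is visible in some truncation.
\<close>
lemma bseries_eq_truncI:
  assumes "\<And>N. trunc N f = trunc N g"
  shows "f = g"
proof (rule bseries_eqI)
  fix \<alpha> :: "nat \<Rightarrow>\<^sub>0 nat"
  have sub: "Poly_Mapping.keys \<alpha> \<subseteq> {..Max (Poly_Mapping.keys \<alpha>)}" by auto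
  have "coeff_of (trunc (Max (Poly_Mapping.keys \<alpha>)) f) \<alpha> = coeff_of (trunc (Max (Poly_Mapping.keys \<alpha>)) g) \<alpha>"
    by (simp only: assms)
  then show "coeff_of f \<alpha> = coeff_of g \<alpha>" using sub by (simp add: trunc.rep_eq)
qed

text \<open>
  Truncation turns a formal sum into a sum in the ring, provided that only finitely many of its
  monomials survive.
\<close>
lemma trunc_formal_sum:
  assumes f: "coeff_of f = formal_sum_coeff I e"
    and J: "J = {i \<in> I. Poly_Mapping.keys (e i) \<subseteq> {..N}}" and "finite J"
  shows "trunc N f = (\<Sum>i\<in>J. bmonom (e i))"
proof (rule bseries_eqI)
  fix \<alpha>
  have "coeff_of (\<Sum>i\<in>J. bmonom (e i)) \<alpha> = (\<Sum>i\<in>J. if e i = \<alpha> then 1 else 0)"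
    unfolding coeff_of_sum by (rule sum.cong) (auto simp: coeff_of_bmonom)
  also have "\<dots> = int (card {i \<in> J. e i = \<alpha>})"
    using \<open>finite J\<close> by (simp add: sum.If_cases Int_def)
  also have "{i \<in> J. e i = \<alpha>} = (if Poly_Mapping.keys \<alpha> \<subseteq> {..N} then {i \<in> I. e i = \<alpha>} else {})"
    unfolding J by auto
  finally show "coeff_of (trunc N f) \<alpha> = coeff_of (\<Sum>i\<in>J. bmonom (e i)) \<alpha>"
    by (simp add: trunc.rep_eq f formal_sum_coeff_def)
qed

text \<open>
  Positivity of the exponents enters here: a monomial involves all the variables chosen by its indices, so
  bounding its variables bounds the entries of the filling.
\<close>
lemma keys_sum_single_subset_iff:
  fixes g :: "'b \<Rightarrow> nat" and m :: "'b \<Rightarrow> nat"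
  assumes "finite X" "\<And>x. x \<in> X \<Longrightarrow> g x > 0"
  shows "Poly_Mapping.keys (\<Sum>x\<in>X. Poly_Mapping.single (m x) (g x)) \<subseteq> S \<longleftrightarrow> m ` X \<subseteq> S"
proof
  assume "Poly_Mapping.keys (\<Sum>x\<in>X. Poly_Mapping.single (m x) (g x)) \<subseteq> S"
  then show "m ` X \<subseteq> S" using lookup_sum_single_pos[of X _ g m] assms by blast
next
  assume "m ` X \<subseteq> S"
  moreover have "Poly_Mapping.keys (\<Sum>x\<in>X. Poly_Mapping.single (m x) (g x)) \<subseteq> m ` X"
    using \<open>finite X\<close>
    by (induction X rule: finite_induct) (auto simp: keys_add_nat)
  ultimately show "Poly_Mapping.keys (\<Sum>x\<in>X. Poly_Mapping.single (m x) (g x)) \<subseteq> S" by blast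
qed

definition variable_power :: "nat \<Rightarrow> nat \<Rightarrow> bseries" where
  "variable_power m k = bmonom (Poly_Mapping.single m k)"

lemma trunc_schur_qsym:
  assumes \<gamma>: "\<And>z. z \<in> skew_diagram lam mu \<Longrightarrow> \<gamma> z > 0"
  shows "trunc N (schur_qsym lam mu \<gamma>)
    = (\<Sum>T | T \<in> SSYT lam mu \<and> T \<in> skew_diagram lam mu \<rightarrow>\<^sub>E {1..N}.
         \<Prod>z\<in>skew_diagram lam mu. variable_power (T z) (\<gamma> z))"
proof -
  let ?D = "skew_diagram lam mu"
  let ?J = "{T. T \<in> SSYT lam mu \<and> T \<in> ?D \<rightarrow>\<^sub>E {1..N}}"
  have "trunc N (schur_qsym lam mu \<gamma>) = (\<Sum>T\<in>?J. bmonom (tableau_monomial lam mu \<gamma> T))"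
  proof (rule trunc_formal_sum[where I = "SSYT lam mu"])
    show "?J = {T \<in> SSYT lam mu. Poly_Mapping.keys (tableau_monomial lam mu \<gamma> T) \<subseteq> {..N}}"
    proof (rule Collect_cong, rule conj_cong[OF refl])
      fix T assume "T \<in> SSYT lam mu"
      have keys: "Poly_Mapping.keys (tableau_monomial lam mu \<gamma> T) \<subseteq> {..N} \<longleftrightarrow> T ` ?D \<subseteq> {..N}"
        unfolding tableau_monomial_def by (rule keys_sum_single_subset_iff) (use \<gamma> in auto)
      from \<open>T \<in> SSYT lam mu\<close> have "T \<in> ?D \<rightarrow>\<^sub>E {1..}" by (simp add: SSYT_def fillings_def)
      then show "T \<in> ?D \<rightarrow>\<^sub>E {1..N} \<longleftrightarrow> Poly_Mapping.keys (tableau_monomial lam mu \<gamma> T) \<subseteq> {..N}"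
        unfolding keys by (force simp: PiE_iff)
    qed
    show "finite ?J"
      by (rule finite_subset[of _ "?D \<rightarrow>\<^sub>E {1..N}"]) (auto intro: finite_PiE)
  qed (rule schur_qsym.rep_eq)
  then show ?thesis by (simp add: tableau_monomial_def bmonom_sum variable_power_def)
qed

lemma trunc_seq_qsym:
  assumes f: "coeff_of f = formal_sum_coeff
      {m. length m = length \<gamma> \<and> set m \<subseteq> {1..} \<and> sorted_wrt R m} (seq_monomial \<gamma>)"
    and \<gamma>: "\<forall>g\<in>set \<gamma>. g > 0"
  shows "trunc N f = (\<Sum>m | length m = length \<gamma> \<and> set m \<subseteq> {1..N} \<and> sorted_wrt R m.
      \<Prod>k<length \<gamma>. variable_power (m ! k) (\<gamma> ! k))"
proof -
  let ?J = "{m. length m = length \<gamma> \<and> set m \<subseteq> {1..N} \<and> sorted_wrt R m}"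
  have "trunc N f = (\<Sum>m\<in>?J. bmonom (seq_monomial \<gamma> m))"
  proof (rule trunc_formal_sum[OF f])
    have keys: "Poly_Mapping.keys (seq_monomial \<gamma> m) \<subseteq> {..N} \<longleftrightarrow> set m \<subseteq> {..N}"
      if "length m = length \<gamma>" for m
    proof -
      have "Poly_Mapping.keys (seq_monomial \<gamma> m) \<subseteq> {..N} \<longleftrightarrow> (!) m ` {..<length \<gamma>} \<subseteq> {..N}"
        unfolding seq_monomial_def by (rule keys_sum_single_subset_iff) (use \<gamma> in auto)
      also have "(!) m ` {..<length \<gamma>} = set m"
        using that by (auto simp: set_conv_nth)
      finally show ?thesis .
    qed
    show "?J = {m \<in> {m. length m = length \<gamma> \<and> set m \<subseteq> {1..} \<and> sorted_wrt R m}.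
        Poly_Mapping.keys (seq_monomial \<gamma> m) \<subseteq> {..N}}"
    proof -
      have "set m \<subseteq> {1..N} \<longleftrightarrow> set m \<subseteq> {1..} \<and> set m \<subseteq> {..N}" for m by auto
      then show ?thesis using keys by blast
    qed
    show "finite ?J"
      by (rule finite_subset[of _ "{m. set m \<subseteq> {1..N} \<and> length m = length \<gamma>}"])
        (auto intro: finite_lists_length_eq)
  qed
  then show ?thesis by (simp add: seq_monomial_def bmonom_sum variable_power_def)
qed

section \<open>From diagrams and sequences to tableau sums\<close>

text \<open>
  Coordinates \<open>\<phi>\<close> on an index set \<open>D\<close> transport the tableau conditions to functions on \<open>D\<close>. This is used
  for a skew diagram read by rows, for a skew diagram read by columns, and for positions in a sequence.
\<close>
lemma tab_sum_reindex:
  fixes D :: "'b set" and \<phi> :: "'b \<Rightarrow> nat \<times> int" and x :: "nat \<Rightarrow> int \<Rightarrow> 'a :: comm_ring_1"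
  assumes \<phi>: "bij_betw \<phi> D (cells n p q)"
    and w: "\<And>m z. z \<in> D \<Longrightarrow> w m z = x m (snd (\<phi> z) - int (fst (\<phi> z)))"
  shows "tab_sum R C x n p q N
    = (\<Sum>T | T \<in> D \<rightarrow>\<^sub>E {1..N} \<and>
         (\<forall>y\<in>D. \<forall>z\<in>D. fst (\<phi> y) = fst (\<phi> z) \<longrightarrow> snd (\<phi> y) < snd (\<phi> z) \<longrightarrow> R (T y) (T z)) \<and>
         (\<forall>y\<in>D. \<forall>z\<in>D. snd (\<phi> y) = snd (\<phi> z) \<longrightarrow> fst (\<phi> y) < fst (\<phi> z) \<longrightarrow> C (T y) (T z)).
       \<Prod>z\<in>D. w (T z) z)"
proof -
  let ?K = "cells n p q"
  define \<psi> where "\<psi> = the_inv_into D \<phi>"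
  have img: "\<phi> z \<in> ?K" if "z \<in> D" for z using \<phi> that by (auto simp: bij_betw_def)
  have inv1: "\<psi> (\<phi> z) = z" if "z \<in> D" for z
    using \<phi> that unfolding \<psi>_def bij_betw_def by (auto intro: the_inv_into_f_f)
  have inv2: "\<phi> (\<psi> c) = c" "\<psi> c \<in> D" if "c \<in> ?K" for c
    using \<phi> that unfolding \<psi>_def bij_betw_def
    by (auto intro: f_the_inv_into_f the_inv_into_into)
  have weight: "(\<Prod>(i, j)\<in>?K. x (T (i, j)) (j - int i)) = (\<Prod>z\<in>D. w (T (\<phi> z)) z)" for T
    by (subst prod.reindex_bij_betw[OF \<phi>, symmetric]) (auto simp: w case_prod_unfold intro!: prod.cong)
  have rows: "(\<forall>i j l. (i, j) \<in> ?K \<longrightarrow> (i, l) \<in> ?K \<longrightarrow> j < l \<longrightarrow> R (T (i, j)) (T (i, l))) \<longleftrightarrow>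
      (\<forall>y\<in>D. \<forall>z\<in>D. fst (\<phi> y) = fst (\<phi> z) \<longrightarrow> snd (\<phi> y) < snd (\<phi> z) \<longrightarrow> R (T (\<phi> y)) (T (\<phi> z)))" for T
  proof (intro iffI ballI impI allI)
    fix y z assume *: "\<forall>i j l. (i, j) \<in> ?K \<longrightarrow> (i, l) \<in> ?K \<longrightarrow> j < l \<longrightarrow> R (T (i, j)) (T (i, l))"
      "y \<in> D" "z \<in> D" "fst (\<phi> y) = fst (\<phi> z)" "snd (\<phi> y) < snd (\<phi> z)"
    show "R (T (\<phi> y)) (T (\<phi> z))"
      using *(1)[rule_format, of "fst (\<phi> y)" "snd (\<phi> y)" "snd (\<phi> z)"] img[OF *(2)] img[OF *(3)] *(4,5)
      by (metis prod.collapse)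
  next
    fix i j l assume *: "\<forall>y\<in>D. \<forall>z\<in>D. fst (\<phi> y) = fst (\<phi> z) \<longrightarrow> snd (\<phi> y) < snd (\<phi> z) \<longrightarrow> R (T (\<phi> y)) (T (\<phi> z))"
      "(i, j) \<in> ?K" "(i, l) \<in> ?K" "j < l"
    show "R (T (i, j)) (T (i, l))"
      using *(1)[rule_format, OF inv2(2)[OF *(2)] inv2(2)[OF *(3)]] inv2(1)[OF *(2)] inv2(1)[OF *(3)] *(4)
      by simp
  qed
  have cols: "(\<forall>i k j. (i, j) \<in> ?K \<longrightarrow> (k, j) \<in> ?K \<longrightarrow> i < k \<longrightarrow> C (T (i, j)) (T (k, j))) \<longleftrightarrow>
      (\<forall>y\<in>D. \<forall>z\<in>D. snd (\<phi> y) = snd (\<phi> z) \<longrightarrow> fst (\<phi> y) < fst (\<phi> z) \<longrightarrow> C (T (\<phi> y)) (T (\<phi> z)))" for T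
  proof (intro iffI ballI impI allI)
    fix y z assume *: "\<forall>i k j. (i, j) \<in> ?K \<longrightarrow> (k, j) \<in> ?K \<longrightarrow> i < k \<longrightarrow> C (T (i, j)) (T (k, j))"
      "y \<in> D" "z \<in> D" "snd (\<phi> y) = snd (\<phi> z)" "fst (\<phi> y) < fst (\<phi> z)"
    show "C (T (\<phi> y)) (T (\<phi> z))"
      using *(1)[rule_format, of "fst (\<phi> y)" "snd (\<phi> y)" "fst (\<phi> z)"] img[OF *(2)] img[OF *(3)] *(4,5)
      by (metis prod.collapse)
  next
    fix i k j assume *: "\<forall>y\<in>D. \<forall>z\<in>D. snd (\<phi> y) = snd (\<phi> z) \<longrightarrow> fst (\<phi> y) < fst (\<phi> z) \<longrightarrow> C (T (\<phi> y)) (T (\<phi> z))"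
      "(i, j) \<in> ?K" "(k, j) \<in> ?K" "i < k"
    show "C (T (i, j)) (T (k, j))"
      using *(1)[rule_format, OF inv2(2)[OF *(2)] inv2(2)[OF *(3)]] inv2(1)[OF *(2)] inv2(1)[OF *(3)] *(4)
      by simp
  qed
  show ?thesis
    unfolding tab_sum_def
  proof (rule sum.reindex_bij_witness[of _ "\<lambda>T. \<lambda>c\<in>?K. T (\<psi> c)" "\<lambda>T. \<lambda>z\<in>D. T (\<phi> z)"])
    fix T assume T: "T \<in> tabs R C n p q N"
    note TE = tabsD(1)[OF T]
    show "(\<lambda>c\<in>?K. (\<lambda>z\<in>D. T (\<phi> z)) (\<psi> c)) = T"
      using inv2 PiE_arb[OF TE] by (intro ext) (simp add: restrict_def)
    have "(\<lambda>z\<in>D. T (\<phi> z)) \<in> D \<rightarrow>\<^sub>E {1..N}"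
      using img PiE_mem[OF TE] by (simp only: restrict_PiE_iff) blast
    moreover have "\<forall>y\<in>D. \<forall>z\<in>D. fst (\<phi> y) = fst (\<phi> z) \<longrightarrow> snd (\<phi> y) < snd (\<phi> z) \<longrightarrow> R (T (\<phi> y)) (T (\<phi> z))"
      using T unfolding tabs_def rows by blast
    moreover have "\<forall>y\<in>D. \<forall>z\<in>D. snd (\<phi> y) = snd (\<phi> z) \<longrightarrow> fst (\<phi> y) < fst (\<phi> z) \<longrightarrow> C (T (\<phi> y)) (T (\<phi> z))"
      using T unfolding tabs_def cols by blast
    ultimately show "(\<lambda>z\<in>D. T (\<phi> z)) \<in> {T. T \<in> D \<rightarrow>\<^sub>E {1..N} \<and>
         (\<forall>y\<in>D. \<forall>z\<in>D. fst (\<phi> y) = fst (\<phi> z) \<longrightarrow> snd (\<phi> y) < snd (\<phi> z) \<longrightarrow> R (T y) (T z)) \<and>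
         (\<forall>y\<in>D. \<forall>z\<in>D. snd (\<phi> y) = snd (\<phi> z) \<longrightarrow> fst (\<phi> y) < fst (\<phi> z) \<longrightarrow> C (T y) (T z))}"
      by simp
    show "(\<Prod>z\<in>D. w ((\<lambda>z\<in>D. T (\<phi> z)) z) z) = (\<Prod>(i, j)\<in>?K. x (T (i, j)) (j - int i))"
      unfolding weight by (rule prod.cong) simp_all
  next
    fix T assume "T \<in> {T. T \<in> D \<rightarrow>\<^sub>E {1..N} \<and>
         (\<forall>y\<in>D. \<forall>z\<in>D. fst (\<phi> y) = fst (\<phi> z) \<longrightarrow> snd (\<phi> y) < snd (\<phi> z) \<longrightarrow> R (T y) (T z)) \<and>
         (\<forall>y\<in>D. \<forall>z\<in>D. snd (\<phi> y) = snd (\<phi> z) \<longrightarrow> fst (\<phi> y) < fst (\<phi> z) \<longrightarrow> C (T y) (T z))}"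
    then have T: "T \<in> D \<rightarrow>\<^sub>E {1..N}"
        "\<forall>y\<in>D. \<forall>z\<in>D. fst (\<phi> y) = fst (\<phi> z) \<longrightarrow> snd (\<phi> y) < snd (\<phi> z) \<longrightarrow> R (T y) (T z)"
        "\<forall>y\<in>D. \<forall>z\<in>D. snd (\<phi> y) = snd (\<phi> z) \<longrightarrow> fst (\<phi> y) < fst (\<phi> z) \<longrightarrow> C (T y) (T z)"
      by blast+
    let ?T = "\<lambda>c\<in>?K. T (\<psi> c)"
    have val: "?T (\<phi> z) = T z" if "z \<in> D" for z using img[OF that] inv1[OF that] by simp
    show "(\<lambda>z\<in>D. ?T (\<phi> z)) = T"
      using val PiE_arb[OF T(1)] by (intro ext) (simp add: restrict_def)
    have "?T \<in> ?K \<rightarrow>\<^sub>E {1..N}"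
      using inv2 PiE_mem[OF T(1)] by (simp only: restrict_PiE_iff) blast
    then show "?T \<in> tabs R C n p q N"
      unfolding tabs_def mem_Collect_eq rows cols using T(2,3) val by simp
  qed
qed

text \<open>
  In a single row the column condition is empty, so \<open>C\<close> is arbitrary.
\<close>
lemma trunc_seq_qsym_eq_tab_sum:
  fixes c :: "int \<Rightarrow> nat"
  assumes f: "coeff_of f = formal_sum_coeff
      {m. length m = length \<gamma> \<and> set m \<subseteq> {1..} \<and> sorted_wrt R m} (seq_monomial \<gamma>)"
    and c: "\<And>k. c k > 0" and \<gamma>: "\<gamma> = map (\<lambda>k. c (a + k)) [1..int n]"
  shows "trunc N f = tab_sum R C (\<lambda>m k. variable_power m (c k)) 1 (\<lambda>_. a) (\<lambda>_. a + int n) N"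
proof -
  define \<phi> :: "nat \<Rightarrow> nat \<times> int" where "\<phi> = (\<lambda>k. (0, a + int k + 1))"
  have len: "length \<gamma> = n" and nth: "k < n \<Longrightarrow> \<gamma> ! k = c (a + (1 + int k))" for k
    by (auto simp: \<gamma> nth_upto)
  have \<phi>: "bij_betw \<phi> {..<n} (cells 1 (\<lambda>_. a) (\<lambda>_. a + int n))"
    by (rule bij_betw_byWitness[where f' = "\<lambda>(i, j). nat (j - a - 1)"]) (auto simp: \<phi>_def)
  have "tab_sum R C (\<lambda>m k. variable_power m (c k)) 1 (\<lambda>_. a) (\<lambda>_. a + int n) N
    = (\<Sum>T | T \<in> {..<n} \<rightarrow>\<^sub>E {1..N} \<and>
         (\<forall>y\<in>{..<n}. \<forall>z\<in>{..<n}. fst (\<phi> y) = fst (\<phi> z) \<longrightarrow> snd (\<phi> y) < snd (\<phi> z) \<longrightarrow> R (T y) (T z)) \<and>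
         (\<forall>y\<in>{..<n}. \<forall>z\<in>{..<n}. snd (\<phi> y) = snd (\<phi> z) \<longrightarrow> fst (\<phi> y) < fst (\<phi> z) \<longrightarrow> C (T y) (T z)).
       \<Prod>z<n. variable_power (T z) (\<gamma> ! z))"
    by (rule tab_sum_reindex[OF \<phi>]) (simp add: \<phi>_def nth add_ac)
  also have "\<dots> = (\<Sum>T | T \<in> {..<n} \<rightarrow>\<^sub>E {1..N} \<and> (\<forall>y<n. \<forall>z<n. y < z \<longrightarrow> R (T y) (T z)).
       \<Prod>z<n. variable_power (T z) (\<gamma> ! z))"
    by (rule sum.cong) (auto simp: \<phi>_def)
  also have "\<dots> = (\<Sum>m | length m = n \<and> set m \<subseteq> {1..N} \<and> sorted_wrt R m.
      \<Prod>k<n. variable_power (m ! k) (\<gamma> ! k))"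
    by (rule sum.reindex_bij_witness[of _ "\<lambda>m. \<lambda>k\<in>{..<n}. m ! k" "\<lambda>T. map T [0..<n]"])
      (auto simp: sorted_wrt_iff_nth_less PiE_iff extensional_def restrict_def subset_iff
        intro!: nth_equalityI)
  finally show ?thesis
    using trunc_seq_qsym[OF f, of N] c len by (simp add: \<gamma>)
qed

lemma part_antimono:
  assumes "is_partition lam" "1 \<le> i" "i \<le> k"
  shows "part lam k \<le> part lam i"
  using assms sorted_wrt_nth_less[of "(\<ge>)" lam "i - 1" "k - 1"]
  by (cases "i = k") (auto simp: part_def is_partition_def)

text \<open>
  The rows of length at least \<open>j\<close> form an initial segment, so counting them locates the last one.
\<close>
lemma le_conj_part_iff:
  assumes lam: "is_partition lam" and "1 \<le> i" "1 \<le> j"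
  shows "i \<le> conj_part lam j \<longleftrightarrow> j \<le> part lam i"
proof -
  let ?A = "{k \<in> {1..length lam}. j \<le> part lam k}"
  have down: "{1..k} \<subseteq> ?A" if "k \<in> ?A" for k
    using that part_antimono[OF lam, of _ k] by fastforce
  have out: "part lam k = 0" if "k > length lam" for k using that by (simp add: part_def)
  show ?thesis
  proof
    assume "j \<le> part lam i"
    then have "i \<in> ?A" using out[of i] assms by force
    then have "card {1..i} \<le> card ?A" by (intro card_mono down) auto
    then show "i \<le> conj_part lam j" by (simp add: conj_part_def)
  next
    assume i: "i \<le> conj_part lam j"
    show "j \<le> part lam i"
    proof (rule ccontr)
      assume "\<not> j \<le> part lam i"
      then have "k < i" if "k \<in> ?A" for k
        using part_antimono[OF lam \<open>1 \<le> i\<close>, of k] that by (cases "k < i") auto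
      then have "?A \<subseteq> {1..<i}" by auto
      then have "card ?A \<le> card {1..<i}" by (intro card_mono) auto
      then show False using i \<open>1 \<le> i\<close> by (simp add: conj_part_def)
    qed
  qed
qed

lemma mem_diagram_iff: "(i, j) \<in> diagram lam \<longleftrightarrow> 1 \<le> i \<and> 1 \<le> j \<and> j \<le> part lam i"
  by (auto simp: diagram_def part_def)

lemma part_mono_of_diagram:
  assumes "diagram mu \<subseteq> diagram lam" "1 \<le> i"
  shows "part mu i \<le> part lam i"
proof (cases "part mu i = 0")
  case False
  then have "(i, part mu i) \<in> diagram mu" using assms by (simp add: mem_diagram_iff)
  then have "(i, part mu i) \<in> diagram lam" using assms(1) by blast
  then show ?thesis by (simp add: mem_diagram_iff)
qed simp

section \<open>Truncated matrix entries and Schur type functions\<close>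

text \<open>
  The conventions for \<open>n \<le> 0\<close> are values of the recursion: a row without cells has
  exactly one filling, of weight \<open>1\<close>, and no sequence ends before its start.
\<close>
lemma trunc_essential_entry:
  fixes c :: "int \<Rightarrow> nat"
  assumes c: "\<And>k. c k > 0"
  shows "trunc N (if n < 0 then 0 else if n = 0 then 1 else essential_qsym (map (\<lambda>k. c (a + k)) [1..n]))
    = complete_sum (\<lambda>m k. variable_power m (c k)) N a (a + n)"
proof -
  have "complete_sum (\<lambda>m k. variable_power m (c k)) N a a = 1"
    unfolding complete_sum_eq_tab_sum by (simp add: tab_sum_def tabs_def cells_def)
  moreover have "trunc N (essential_qsym (map (\<lambda>k. c (a + k)) [1..n]))
      = complete_sum (\<lambda>m k. variable_power m (c k)) N a (a + n)" if "n > 0"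
    unfolding complete_sum_eq_tab_sum
    using trunc_seq_qsym_eq_tab_sum[where c = c and a = a and n = "nat n" and N = N and C = "(<)",
        OF essential_qsym.rep_eq c refl] that
    by simp
  ultimately show ?thesis
    by (cases n "0 :: int" rule: linorder_cases) (simp_all add: complete_sum_eq_0)
qed

lemma elementary_sum_eq_0: "b < a \<Longrightarrow> elementary_sum x N a b = 0"
  unfolding elementary_sum_eq_tab_sum by simp

lemma trunc_monomial_entry:
  fixes c :: "int \<Rightarrow> nat"
  assumes c: "\<And>k. c k > 0"
  shows "trunc N (if n < 0 then 0 else if n = 0 then 1 else monomial_qsym (map (\<lambda>k. c (a + k)) [1..n]))
    = elementary_sum (\<lambda>m k. variable_power m (c k)) N a (a + n)"
proof -
  have "elementary_sum (\<lambda>m k. variable_power m (c k)) N a a = 1"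
    unfolding elementary_sum_eq_tab_sum by (simp add: tab_sum_def tabs_def cells_def)
  moreover have "trunc N (monomial_qsym (map (\<lambda>k. c (a + k)) [1..n]))
      = elementary_sum (\<lambda>m k. variable_power m (c k)) N a (a + n)" if "n > 0"
    unfolding elementary_sum_eq_tab_sum
    using trunc_seq_qsym_eq_tab_sum[where c = c and a = a and n = "nat n" and N = N and C = "(\<le>)",
        OF monomial_qsym.rep_eq c refl] that
    by simp
  ultimately show ?thesis
    by (cases n "0 :: int" rule: linorder_cases) (simp_all add: elementary_sum_eq_0)
qed

text \<open>
  Row numbers drop by one while column numbers do not, so contents grow by one; hence the weight
  \<open>c (k - 1)\<close>.
\<close>
lemma trunc_schur_qsym_rows:
  fixes c :: "int \<Rightarrow> nat"
  assumes len: "length mu = length lam"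
    and \<gamma>: "\<And>i j. (i, j) \<in> skew_diagram lam mu \<Longrightarrow> \<gamma> (i, j) = c (int j - int i)"
    and c: "\<And>k. c k > 0"
  shows "trunc N (schur_qsym lam mu \<gamma>) = tab_sum (\<le>) (<) (\<lambda>m k. variable_power m (c (k - 1))) (length lam)
      (\<lambda>i. int (part mu (Suc i))) (\<lambda>i. int (part lam (Suc i))) N"
proof -
  let ?D = "skew_diagram lam mu"
  define \<phi> :: "nat \<times> nat \<Rightarrow> nat \<times> int" where "\<phi> = (\<lambda>(i, j). (i - 1, int j))"
  have mem: "(i, j) \<in> ?D \<longleftrightarrow> 1 \<le> i \<and> i \<le> length lam \<and> part mu i < j \<and> j \<le> part lam i" for i j
    using len by (auto simp: skew_diagram_def diagram_def)
  have bij: "bij_betw \<phi> ?D (cells (length lam) (\<lambda>i. int (part mu (Suc i))) (\<lambda>i. int (part lam (Suc i))))"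
    by (rule bij_betw_byWitness[where f' = "\<lambda>(i, j). (Suc i, nat j)"]) (auto simp: \<phi>_def mem)
  have "trunc N (schur_qsym lam mu \<gamma>)
      = (\<Sum>T | T \<in> SSYT lam mu \<and> T \<in> ?D \<rightarrow>\<^sub>E {1..N}. \<Prod>z\<in>?D. variable_power (T z) (\<gamma> z))"
    by (rule trunc_schur_qsym) (use \<gamma> c in force)
  also have "\<dots> = (\<Sum>T | T \<in> ?D \<rightarrow>\<^sub>E {1..N} \<and>
         (\<forall>y\<in>?D. \<forall>z\<in>?D. fst (\<phi> y) = fst (\<phi> z) \<longrightarrow> snd (\<phi> y) < snd (\<phi> z) \<longrightarrow> T y \<le> T z) \<and>
         (\<forall>y\<in>?D. \<forall>z\<in>?D. snd (\<phi> y) = snd (\<phi> z) \<longrightarrow> fst (\<phi> y) < fst (\<phi> z) \<longrightarrow> T y < T z).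
       \<Prod>z\<in>?D. variable_power (T z) (\<gamma> z))"
  proof (rule sum.cong[OF _ refl], rule Collect_cong)
    fix T :: "nat \<times> nat \<Rightarrow> nat"
    have order: "fst (\<phi> y) = fst (\<phi> z) \<longleftrightarrow> fst y = fst z" "fst (\<phi> y) < fst (\<phi> z) \<longleftrightarrow> fst y < fst z"
        "snd (\<phi> y) = snd (\<phi> z) \<longleftrightarrow> snd y = snd z" "snd (\<phi> y) < snd (\<phi> z) \<longleftrightarrow> snd y < snd z"
      if "y \<in> ?D" "z \<in> ?D" for y z
      using that by (cases y; cases z; auto simp: \<phi>_def mem)+
    have "?D \<rightarrow>\<^sub>E {1..N} \<subseteq> ?D \<rightarrow>\<^sub>E {1..}" by (rule PiE_mono) auto
    then have pos: "T \<in> ?D \<rightarrow>\<^sub>E {1..N} \<Longrightarrow> T \<in> ?D \<rightarrow>\<^sub>E {1..}" by blast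
    have rows: "(\<forall>y\<in>?D. \<forall>z\<in>?D. fst (\<phi> y) = fst (\<phi> z) \<longrightarrow> snd (\<phi> y) < snd (\<phi> z) \<longrightarrow> T y \<le> T z) \<longleftrightarrow>
        (\<forall>i j l. (i, j) \<in> ?D \<longrightarrow> (i, l) \<in> ?D \<longrightarrow> j < l \<longrightarrow> T (i, j) \<le> T (i, l))"
      by (simp add: order cong: ball_cong) (auto simp: Ball_def)
    have cols: "(\<forall>y\<in>?D. \<forall>z\<in>?D. snd (\<phi> y) = snd (\<phi> z) \<longrightarrow> fst (\<phi> y) < fst (\<phi> z) \<longrightarrow> T y < T z) \<longleftrightarrow>
        (\<forall>i j k. (i, j) \<in> ?D \<longrightarrow> (k, j) \<in> ?D \<longrightarrow> i < k \<longrightarrow> T (i, j) < T (k, j))"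
      by (simp add: order cong: ball_cong) (auto simp: Ball_def)
    show "T \<in> SSYT lam mu \<and> T \<in> ?D \<rightarrow>\<^sub>E {1..N} \<longleftrightarrow> T \<in> ?D \<rightarrow>\<^sub>E {1..N} \<and>
         (\<forall>y\<in>?D. \<forall>z\<in>?D. fst (\<phi> y) = fst (\<phi> z) \<longrightarrow> snd (\<phi> y) < snd (\<phi> z) \<longrightarrow> T y \<le> T z) \<and>
         (\<forall>y\<in>?D. \<forall>z\<in>?D. snd (\<phi> y) = snd (\<phi> z) \<longrightarrow> fst (\<phi> y) < fst (\<phi> z) \<longrightarrow> T y < T z)"
      unfolding rows cols SSYT_def fillings_def mem_Collect_eq
      by (rule iffI; elim conjE; intro conjI; (assumption | erule pos))
  qed
  also have "\<dots> = tab_sum (\<le>) (<) (\<lambda>m k. variable_power m (c (k - 1))) (length lam)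
      (\<lambda>i. int (part mu (Suc i))) (\<lambda>i. int (part lam (Suc i))) N"
  proof (rule tab_sum_reindex[OF bij, symmetric])
    fix m z assume "z \<in> ?D"
    then show "variable_power m (\<gamma> z) = variable_power m (c (snd (\<phi> z) - int (fst (\<phi> z)) - 1))"
      by (cases z) (auto simp: \<gamma> \<phi>_def mem of_nat_diff)
  qed
  finally show ?thesis .
qed

text \<open>
  Reading by columns exchanges the coordinates and so negates contents; the shift of the
  column numbers by one then makes \<open>1 - k\<close> the original content. Inclusion in the rectangle guarantees that
  \<open>s\<close> columns exhaust the diagram.
\<close>
lemma trunc_schur_qsym_cols:
  fixes c :: "int \<Rightarrow> nat"
  assumes lam: "is_partition lam" and mu: "is_partition mu"
    and sub: "diagram lam \<subseteq> diagram (replicate (length lam) s)"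
    and \<gamma>: "\<And>i j. (i, j) \<in> skew_diagram lam mu \<Longrightarrow> \<gamma> (i, j) = c (int j - int i)"
    and c: "\<And>k. c k > 0"
  shows "trunc N (schur_qsym lam mu \<gamma>) = tab_sum (<) (\<le>) (\<lambda>m k. variable_power m (c (1 - k))) s
      (\<lambda>j. int (conj_part mu (Suc j))) (\<lambda>j. int (conj_part lam (Suc j))) N"
proof -
  let ?D = "skew_diagram lam mu"
  define \<phi> :: "nat \<times> nat \<Rightarrow> nat \<times> int" where "\<phi> = (\<lambda>(i, j). (j - 1, int i))"
  have "j \<le> s" if "(i, j) \<in> diagram lam" for i j
    using that sub by (force simp: diagram_def part_def)
  then have mem: "(i, j) \<in> ?D \<longleftrightarrow> 1 \<le> j \<and> j \<le> s \<and> conj_part mu j < i \<and> i \<le> conj_part lam j" for i j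
    using le_conj_part_iff[OF lam, of i j] le_conj_part_iff[OF mu, of i j]
    by (cases "1 \<le> i") (auto simp: skew_diagram_def mem_diagram_iff)
  have bij: "bij_betw \<phi> ?D (cells s (\<lambda>j. int (conj_part mu (Suc j))) (\<lambda>j. int (conj_part lam (Suc j))))"
    by (rule bij_betw_byWitness[where f' = "\<lambda>(j, i). (nat i, Suc j)"]) (auto simp: \<phi>_def mem)
  have "trunc N (schur_qsym lam mu \<gamma>)
      = (\<Sum>T | T \<in> SSYT lam mu \<and> T \<in> ?D \<rightarrow>\<^sub>E {1..N}. \<Prod>z\<in>?D. variable_power (T z) (\<gamma> z))"
    by (rule trunc_schur_qsym) (use \<gamma> c in force)
  also have "\<dots> = (\<Sum>T | T \<in> ?D \<rightarrow>\<^sub>E {1..N} \<and>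
         (\<forall>y\<in>?D. \<forall>z\<in>?D. fst (\<phi> y) = fst (\<phi> z) \<longrightarrow> snd (\<phi> y) < snd (\<phi> z) \<longrightarrow> T y < T z) \<and>
         (\<forall>y\<in>?D. \<forall>z\<in>?D. snd (\<phi> y) = snd (\<phi> z) \<longrightarrow> fst (\<phi> y) < fst (\<phi> z) \<longrightarrow> T y \<le> T z).
       \<Prod>z\<in>?D. variable_power (T z) (\<gamma> z))"
  proof (rule sum.cong[OF _ refl], rule Collect_cong)
    fix T :: "nat \<times> nat \<Rightarrow> nat"
    have order: "fst (\<phi> y) = fst (\<phi> z) \<longleftrightarrow> snd y = snd z" "fst (\<phi> y) < fst (\<phi> z) \<longleftrightarrow> snd y < snd z"
        "snd (\<phi> y) = snd (\<phi> z) \<longleftrightarrow> fst y = fst z" "snd (\<phi> y) < snd (\<phi> z) \<longleftrightarrow> fst y < fst z"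
      if "y \<in> ?D" "z \<in> ?D" for y z
      using that by (cases y; cases z; auto simp: \<phi>_def mem)+
    have "?D \<rightarrow>\<^sub>E {1..N} \<subseteq> ?D \<rightarrow>\<^sub>E {1..}" by (rule PiE_mono) auto
    then have pos: "T \<in> ?D \<rightarrow>\<^sub>E {1..N} \<Longrightarrow> T \<in> ?D \<rightarrow>\<^sub>E {1..}" by blast
    have cols: "(\<forall>y\<in>?D. \<forall>z\<in>?D. fst (\<phi> y) = fst (\<phi> z) \<longrightarrow> snd (\<phi> y) < snd (\<phi> z) \<longrightarrow> T y < T z) \<longleftrightarrow>
        (\<forall>i j k. (i, j) \<in> ?D \<longrightarrow> (k, j) \<in> ?D \<longrightarrow> i < k \<longrightarrow> T (i, j) < T (k, j))"
      by (simp add: order cong: ball_cong) (auto simp: Ball_def)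
    have rows: "(\<forall>y\<in>?D. \<forall>z\<in>?D. snd (\<phi> y) = snd (\<phi> z) \<longrightarrow> fst (\<phi> y) < fst (\<phi> z) \<longrightarrow> T y \<le> T z) \<longleftrightarrow>
        (\<forall>i j l. (i, j) \<in> ?D \<longrightarrow> (i, l) \<in> ?D \<longrightarrow> j < l \<longrightarrow> T (i, j) \<le> T (i, l))"
      by (simp add: order cong: ball_cong) (auto simp: Ball_def)
    show "T \<in> SSYT lam mu \<and> T \<in> ?D \<rightarrow>\<^sub>E {1..N} \<longleftrightarrow> T \<in> ?D \<rightarrow>\<^sub>E {1..N} \<and>
         (\<forall>y\<in>?D. \<forall>z\<in>?D. fst (\<phi> y) = fst (\<phi> z) \<longrightarrow> snd (\<phi> y) < snd (\<phi> z) \<longrightarrow> T y < T z) \<and>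
         (\<forall>y\<in>?D. \<forall>z\<in>?D. snd (\<phi> y) = snd (\<phi> z) \<longrightarrow> fst (\<phi> y) < fst (\<phi> z) \<longrightarrow> T y \<le> T z)"
      unfolding rows cols SSYT_def fillings_def mem_Collect_eq
      by (rule iffI; elim conjE; intro conjI; (assumption | erule pos))
  qed
  also have "\<dots> = tab_sum (<) (\<le>) (\<lambda>m k. variable_power m (c (1 - k))) s
      (\<lambda>j. int (conj_part mu (Suc j))) (\<lambda>j. int (conj_part lam (Suc j))) N"
  proof (rule tab_sum_reindex[OF bij, symmetric])
    fix m z assume "z \<in> ?D"
    then show "variable_power m (\<gamma> z) = variable_power m (c (1 - (snd (\<phi> z) - int (fst (\<phi> z)))))"
      by (cases z) (auto simp: \<gamma> \<phi>_def mem of_nat_diff)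
  qed
  finally show ?thesis .
qed

lemma conj_part_antimono: "i \<le> k \<Longrightarrow> conj_part lam k \<le> conj_part lam i"
  unfolding conj_part_def by (rule card_mono) auto

lemma conj_part_mono:
  assumes "diagram mu \<subseteq> diagram lam" "length mu = length lam"
  shows "conj_part mu i \<le> conj_part lam i"
  unfolding conj_part_def assms(2)
proof (rule card_mono)
  show "{j \<in> {1..length lam}. i \<le> part mu j} \<subseteq> {j \<in> {1..length lam}. i \<le> part lam j}"
  proof
    fix j assume "j \<in> {j \<in> {1..length lam}. i \<le> part mu j}"
    then show "j \<in> {j \<in> {1..length lam}. i \<le> part lam j}"
      using part_mono_of_diagram[OF assms(1), of j] by simp
  qed
qed simp

section \<open>The determinant formulas\<close>

lemma map_mat_mat: "map_mat h (mat n m M) = mat n m (\<lambda>z. h (M z))"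
  by (rule eq_matI) simp_all

theorem theorem5p3:
  fixes r s :: nat
    and lam mu :: "nat list"
    and \<gamma> :: "nat \<times> nat \<Rightarrow> nat"
    and c :: "int \<Rightarrow> nat"
  assumes "r > 0" and "s > 0"
    and "is_partition lam" and "length lam = r"
    and "is_partition mu" and "length mu = r"
    and "diagram mu \<subseteq> diagram lam"
    and "diagram lam \<subseteq> diagram (replicate r s)"
    and "\<gamma> \<in> diag_fillings lam mu {1..}"
    and "\<And>k. c k > 0"
    and "\<And>i j. (i, j) \<in> skew_diagram lam mu \<Longrightarrow> \<gamma> (i, j) = c (int j - int i)"
  shows "schur_qsym lam mu \<gamma> =
      det (mat r r (\<lambda>(i0, j0).
        let i = Suc i0; j = Suc j0;
            n = int (part lam i) - int (part mu j) - int i + int j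
        in if n < 0 then 0
           else if n = 0 then 1
           else essential_qsym (map (\<lambda>k. c (int (part mu j) - int j + k)) [1..n])))
    \<and> schur_qsym lam mu \<gamma> =
      det (mat s s (\<lambda>(i0, j0).
        let i = Suc i0; j = Suc j0;
            n = int (conj_part lam i) - int (conj_part mu j) - int i + int j
        in if n < 0 then 0
           else if n = 0 then 1
           else monomial_qsym (map (\<lambda>k. c (- int (conj_part mu j) + int j - k)) [1..n])))"
    (is "_ = det (mat r r ?M1) \<and> _ = det (mat s s ?M2)")
proof (rule conjI; rule bseries_eq_truncI)
  fix N
  let ?p = "\<lambda>i. int (part mu (Suc i))" and ?q = "\<lambda>i. int (part lam (Suc i))"
  let ?x = "\<lambda>m k. variable_power m (c (k - 1))"
  have entry: "trunc N (?M1 (i, j)) = complete_sum ?x N (?p j - int j) (?q i - int i)" for i j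
  proof -
    let ?a = "?p j - int j" and ?n = "?q i - ?p j - int (Suc i) + int (Suc j)"
    have arg: "int (part mu (Suc j)) - int (Suc j) + k = ?a + k - 1" for k by simp
    have "?M1 (i, j) = (if ?n < 0 then 0 else if ?n = 0 then 1
        else essential_qsym (map (\<lambda>k. c (?a + k - 1)) [1..?n]))"
      by (simp only: Let_def prod.case arg)
    moreover have "?a + ?n = ?q i - int i" by simp
    ultimately show ?thesis
      using trunc_essential_entry[of "\<lambda>k. c (k - 1)" N ?n ?a, OF assms(10)] by (simp only:)
  qed
  have "trunc N (det (mat r r ?M1)) = det (map_mat (trunc N) (mat r r ?M1))"
    by (rule trunc.hom_det[symmetric])
  also have "\<dots> = det (mat r r (\<lambda>(i, j). complete_sum ?x N (?p j - int j) (?q i - int i)))"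
    unfolding map_mat_mat
  proof (rule arg_cong[of _ _ "\<lambda>M. det (mat r r M)"], rule ext)
    show "trunc N (?M1 z) = (case z of (i, j) \<Rightarrow> complete_sum ?x N (?p j - int j) (?q i - int i))" for z
      by (cases z) (use entry in \<open>simp only: prod.case\<close>)
  qed
  also have "\<dots> = jacobi_trudi (complete_sum ?x N) r ?p ?q" by (simp only: jacobi_trudi_def)
  also have "\<dots> = tab_sum (\<le>) (<) ?x r ?p ?q N"
  proof -
    have "decreasing r ?p" "decreasing r ?q"
      using part_antimono assms(3,5) by (auto simp: decreasing_def)
    moreover have "\<forall>i<r. ?p i \<le> ?q i" using part_mono_of_diagram[OF assms(7)] by simp
    ultimately show ?thesis by (simp add: jacobi_trudi_complete_sum)
  qed
  also have "\<dots> = trunc N (schur_qsym lam mu \<gamma>)"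
    using trunc_schur_qsym_rows[of mu lam \<gamma> c N] assms(4,6,10,11) by simp
  finally show "trunc N (schur_qsym lam mu \<gamma>) = trunc N (det (mat r r ?M1))" by (rule sym)
next
  fix N
  let ?p = "\<lambda>i. int (conj_part mu (Suc i))" and ?q = "\<lambda>i. int (conj_part lam (Suc i))"
  let ?x = "\<lambda>m k. variable_power m (c (1 - k))"
  have entry: "trunc N (?M2 (i, j)) = elementary_sum ?x N (?p j - int j) (?q i - int i)" for i j
  proof -
    let ?a = "?p j - int j" and ?n = "?q i - ?p j - int (Suc i) + int (Suc j)"
    have arg: "- int (conj_part mu (Suc j)) + int (Suc j) - k = 1 - (?a + k)" for k by simp
    have "?M2 (i, j) = (if ?n < 0 then 0 else if ?n = 0 then 1
        else monomial_qsym (map (\<lambda>k. c (1 - (?a + k))) [1..?n]))"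
      by (simp only: Let_def prod.case arg)
    moreover have "?a + ?n = ?q i - int i" by simp
    ultimately show ?thesis
      using trunc_monomial_entry[of "\<lambda>k. c (1 - k)" N ?n ?a, OF assms(10)] by (simp only:)
  qed
  have "trunc N (det (mat s s ?M2)) = det (map_mat (trunc N) (mat s s ?M2))"
    by (rule trunc.hom_det[symmetric])
  also have "\<dots> = det (mat s s (\<lambda>(i, j). elementary_sum ?x N (?p j - int j) (?q i - int i)))"
    unfolding map_mat_mat
  proof (rule arg_cong[of _ _ "\<lambda>M. det (mat s s M)"], rule ext)
    show "trunc N (?M2 z) = (case z of (i, j) \<Rightarrow> elementary_sum ?x N (?p j - int j) (?q i - int i))" for z
      by (cases z) (use entry in \<open>simp only: prod.case\<close>)
  qed
  also have "\<dots> = jacobi_trudi (elementary_sum ?x N) s ?p ?q" by (simp only: jacobi_trudi_def)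
  also have "\<dots> = tab_sum (<) (\<le>) ?x s ?p ?q N"
  proof -
    have "decreasing s ?p" "decreasing s ?q"
      using conj_part_antimono by (auto simp: decreasing_def)
    moreover have "\<forall>i<s. ?p i \<le> ?q i" using conj_part_mono[OF assms(7)] assms(4,6) by simp
    ultimately show ?thesis by (simp add: jacobi_trudi_elementary_sum)
  qed
  also have "\<dots> = trunc N (schur_qsym lam mu \<gamma>)"
    using trunc_schur_qsym_cols[of lam mu s \<gamma> c N] assms(3,4,5,8,10,11) by simp
  finally show "trunc N (schur_qsym lam mu \<gamma>) = trunc N (det (mat s s ?M2))" by (rule sym)
qed

end
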